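(* Let $D,K\in\mathbb{N}$, let $A_1,A_2,a,\varepsilon>0$ be real numbers with $a<1\leq A_1<A_2$, and let $\zeta\in\mathbb{C}$ with $|\zeta|=1$. Let $\{d_n\}_{n\in\mathbb{N}}$ be a sequence of natural numbers and write $D_n=\prod_{i=1}^{n}d_i$. For $i=1,\ldots,K$, let $\{b_{i,n}\}_{n\in\mathbb{N}}$ be a sequence of natural numbers and let $\{\alpha_{i,n}\}_{n\in\mathbb{N}}$ be a sequence of algebraic integers, such that: (1) $|\alpha_{1,n}|<|\alpha_{1,n+1}|$ for all $n\in\mathbb{N}$; (2) $|\alpha_{1,n}|\geq n^{1+\varepsilon}$ for all $n\in\mathbb{N}$; (3) $[\mathbb{Q}(\alpha_{1,n},\ldots,\alpha_{K,n}):\mathbb{Q}]\leq d_n$ for all $n\in\mathbb{N}$; (4) $\liminf_{n\to\infty}|\alpha_{1,n}|^{1/(D^n\prod_{i=1}^{n-1}(KD_i+d_i))}=A_1$; (5) $\limsup_{n\to\infty}|\alpha_{1,n}|^{1/(D^n\prod_{i=1}^{n-1}(KD_i+d_i))}=A_2$; (6) for all $n\in\mathbb{N}$ and all $1<i\leq K$: $2^{-(\log_2|\alpha_{1,n}|)^a}<\frac{|\alpha_{1,n}|}{|\alpha_{i,n}|}<2^{(\log_2|\alpha_{1,n}|)^a}$; (7) for all $n\in\mathbb{N}$ and all $1\leq i\leq K$: $b_{i,n}\,\overline{|\alpha_{i,n}|}\leq 2^{(\log_2|\alpha_{1,n}|)^a}|\alpha_{i,n}|$; (8) for all $n\in\mathbb{N}$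 and all $1\leq i\leq K$: $\mathrm{Re}_\zeta\!\left(\frac{b_{i,n}}{\alpha_{i,n}}\right)>0$; (9) for all $1\leq i<j\leq K$: $\lim_{n\to\infty}\mathrm{Re}_\zeta\!\left(\frac{b_{i,n}}{\alpha_{i,n}}\right)\Big/\mathrm{Re}_\zeta\!\left(\frac{b_{j,n}}{\alpha_{j,n}}\right)=0$. Then $\deg\gamma>D$ whenever $\gamma$ is any non-trivial linear combination with rational coefficients of the numbers $\sum_{n=1}^{\infty}\frac{b_{1,n}}{\alpha_{1,n}},\ldots,\sum_{n=1}^{\infty}\frac{b_{K,n}}{\alpha_{K,n}}$.
   Context: For an algebraic number $\alpha$, $\overline{|\alpha|}$ denotes the house of $\alpha$, i.e. the maximum of the absolute values of the (complex) conjugates of $\alpha$. For $\zeta\in\mathbb{C}\setminus\{0\}$ and $z\in\mathbb{C}$, $\mathrm{Re}_\zeta(z):=\mathrm{Re}(\overline{\zeta}z)$. $\deg\gamma$ denotes the degree of $\gamma$ over $\mathbb{Q}$ (taken to be infinite if $\gamma$ is transcendental). $\mathbb{N}=\{1,2,3,\ldots\}$. *)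

theory Defs
  imports "HOL-Analysis.Analysis" "HOL-Computational_Algebra.Polynomial"
begin

definition min_poly_rat :: "complex \<Rightarrow> rat poly" where
  "min_poly_rat x = (SOME p. p \<noteq> 0 \<and> lead_coeff p = 1 \<and> poly (map_poly of_rat p) x = 0 \<and>
      (\<forall>q. q \<noteq> 0 \<and> poly (map_poly of_rat q) x = 0 \<longrightarrow> degree p \<le> degree q))"

definition conjugates :: "complex \<Rightarrow> complex set" where
  "conjugates x = {z. poly (map_poly of_rat (min_poly_rat x)) z = 0}"

definition house :: "complex \<Rightarrow> real" where
  "house x = Max (norm ` conjugates x)"

text \<open>Degree over Q (infinite for transcendental numbers).\<close>
definition alg_degree :: "complex \<Rightarrow> enat" where
  "alg_degree x = (INF p \<in> {p :: rat poly. p \<noteq> 0 \<and> poly (map_poly of_rat p) x = 0}. enat (degree p))"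

definition gen_subfield :: "complex set \<Rightarrow> complex set" where
  "gen_subfield S = \<Inter>{F. S \<subseteq> F \<and> 0 \<in> F \<and> 1 \<in> F \<and>
      (\<forall>x\<in>F. \<forall>y\<in>F. x + y \<in> F \<and> x * y \<in> F) \<and> (\<forall>x\<in>F. - x \<in> F) \<and>
      (\<forall>x\<in>F. x \<noteq> 0 \<longrightarrow> inverse x \<in> F)}"

definition field_degree_Q :: "complex set \<Rightarrow> nat" where
  "field_degree_Q S = vector_space.dim (\<lambda>(r::rat) (z::complex). of_rat r * z) (gen_subfield S)"

definition Re_dir :: "complex \<Rightarrow> complex \<Rightarrow> real" where
  "Re_dir \<zeta> z = Re (cnj \<zeta> * z)"

end

theory Submission
  imports Defs "Jordan_Normal_Form.Char_Poly" "HOL-Real_Asymp.Real_Asymp"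
begin

text \<open>
  Suppose that a combination \<open>\<gamma>\<close> has degree at most \<open>D\<close>, and let \<open>\<gamma>\<^sub>N\<close> be its partial sum up to \<open>N\<close>.
  By the sign condition (8) and the domination condition (9), \<open>\<gamma> - \<gamma>\<^sub>N\<close> is nonzero for large \<open>N\<close>.
  A fixed multiple of \<open>(\<gamma> - \<gamma>\<^sub>N) \<Prod>\<^sub>n\<^sub>\<le>\<^sub>N \<Prod>\<^sub>i \<alpha>\<^sub>i\<^sub>n\<close> is then a nonzero algebraic integer of degree at
  most \<open>D D\<^sub>N\<close>, so the product of its conjugates has absolute value at least 1, while each conjugate
  is bounded through the houses. Writing \<open>L\<^sub>n = log\<^sub>2 |\<alpha>\<^sub>1\<^sub>n|\<close>, this gives, up to lower order terms,
  \<open>-log\<^sub>2 |\<gamma> - \<gamma>\<^sub>N| \<le> D D\<^sub>N K \<Sum>\<^sub>n\<^sub>\<le>\<^sub>N L\<^sub>n\<close>.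

  Let \<open>E\<^sub>n\<close> be the exponent in (4) and (5), \<open>l\<^sub>n = L\<^sub>n / E\<^sub>n\<close>, and let \<open>\<rho>\<^sub>N\<close> be the right-hand side above
  divided by \<open>E\<^sub>N\<^sub>+\<^sub>1\<close>. The shape of \<open>E\<^sub>n\<close> makes \<open>\<rho>\<^sub>N\<^sub>+\<^sub>1\<close> at most a convex combination of \<open>\<rho>\<^sub>N\<close> and \<open>l\<^sub>N\<^sub>+\<^sub>1\<close>
  with weight at least \<open>1/2\<close> on the latter. Comparing with the size of the tail \<open>\<gamma> - \<gamma>\<^sub>N\<close>, either
  \<open>l\<^sub>N\<^sub>+\<^sub>1 \<le> \<rho>\<^sub>N + \<omega>\<^sub>N\<close> with summable errors \<open>\<omega>\<^sub>N\<close> (near), or \<open>L\<^sub>n\<close> stays of the size of the bound up to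
  some \<open>n > 2N\<close>, which makes \<open>\<rho>\<^sub>n\<close> tiny (far). If \<open>liminf \<rho> = 0\<close> then \<open>l\<close> tends to \<open>0\<close>; otherwise only
  the near case occurs eventually, \<open>\<rho>\<close> converges, and \<open>limsup l \<le> lim \<rho> \<le> liminf l\<close>. Both contradict
  \<open>liminf l < limsup l\<close>.
\<close>

section \<open>Finitely generated subalgebras and algebraic integers\<close>

text \<open>Keeping the coefficient ring abstract treats integrality over the integers and
  algebraicity over the rationals at once.\<close>

definition hom_span :: "('r::comm_ring_1 \<Rightarrow> complex) \<Rightarrow> complex set \<Rightarrow> complex set" where
  "hom_span h B = {x. \<exists>c. x = (\<Sum>b\<in>B. h (c b) * b)}"

text \<open>These conditions make \<open>hom_span h B\<close> a ring that is a finitely generated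
  module. Independence is not asked for, so \<open>card B\<close> is only an upper bound for its
  rank.\<close>

definition subalg_gens :: "('r::comm_ring_1 \<Rightarrow> complex) \<Rightarrow> complex set \<Rightarrow> bool" where
  "subalg_gens h B \<longleftrightarrow> finite B \<and> 1 \<in> hom_span h B \<and> (\<forall>x\<in>B. \<forall>y\<in>B. x * y \<in> hom_span h B)"

context
  fixes h :: "'r::comm_ring_1 \<Rightarrow> complex"
  assumes h: "comm_ring_hom h"
begin

interpretation comm_ring_hom h by (rule h)

lemma hom_span_0: "0 \<in> hom_span h B"
  unfolding hom_span_def by (auto intro!: exI[of _ "\<lambda>_. 0"] simp: hom_zero)

lemma hom_span_add: "x \<in> hom_span h B \<Longrightarrow> y \<in> hom_span h B \<Longrightarrow> x + y \<in> hom_span h B"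
proof -
  assume "x \<in> hom_span h B" "y \<in> hom_span h B"
  then obtain c d where "x = (\<Sum>b\<in>B. h (c b) * b)" "y = (\<Sum>b\<in>B. h (d b) * b)"
    by (auto simp: hom_span_def)
  hence "x + y = (\<Sum>b\<in>B. h (c b + d b) * b)"
    by (simp add: hom_add sum.distrib distrib_right)
  thus ?thesis unfolding hom_span_def by (intro CollectI exI)
qed

lemma hom_span_scale: "x \<in> hom_span h B \<Longrightarrow> h r * x \<in> hom_span h B"
proof -
  assume "x \<in> hom_span h B"
  then obtain c where "x = (\<Sum>b\<in>B. h (c b) * b)" by (auto simp: hom_span_def)
  hence "h r * x = (\<Sum>b\<in>B. h (r * c b) * b)"
    by (simp add: hom_mult sum_distrib_left mult.assoc)
  thus ?thesis unfolding hom_span_def by (intro CollectI exI)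
qed

lemma hom_span_sum: "(\<And>i. i \<in> I \<Longrightarrow> f i \<in> hom_span h B) \<Longrightarrow> sum f I \<in> hom_span h B"
  by (induction I rule: infinite_finite_induct) (auto intro: hom_span_0 hom_span_add)

lemma hom_span_base: "finite B \<Longrightarrow> b \<in> B \<Longrightarrow> b \<in> hom_span h B"
  unfolding hom_span_def
  by (auto intro!: exI[of _ "\<lambda>x. if x = b then 1 else 0"] simp: if_distrib[of h]
      if_distrib[of "\<lambda>z. z * _"] cong: if_cong)

lemma hom_span_least:
  assumes "x \<in> hom_span h B" "\<And>b. b \<in> B \<Longrightarrow> f b \<in> hom_span h C"
    and "\<And>c. f (\<Sum>b\<in>B. h (c b) * b) = (\<Sum>b\<in>B. h (c b) * f b)"
  shows "f x \<in> hom_span h C"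
proof -
  obtain c where x: "x = (\<Sum>b\<in>B. h (c b) * b)" using assms(1) by (auto simp: hom_span_def)
  show ?thesis unfolding x assms(3) by (intro hom_span_sum hom_span_scale assms(2))
qed

lemma hom_span_mult_mult:
  assumes "x \<in> hom_span h B" "y \<in> hom_span h C"
    and BC: "\<And>b c. b \<in> B \<Longrightarrow> c \<in> C \<Longrightarrow> b * c \<in> hom_span h A"
  shows "x * y \<in> hom_span h A"
proof (rule hom_span_least[OF assms(1), where f = "\<lambda>x. x * y"])
  fix b assume "b \<in> B"
  thus "b * y \<in> hom_span h A"
    using BC by (intro hom_span_least[OF assms(2), where f = "\<lambda>y. b * y"])
      (auto simp: sum_distrib_left mult.left_commute)
qed (simp add: sum_distrib_right mult.assoc)

lemma subalg_gens_mult: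
  "subalg_gens h B \<Longrightarrow> x \<in> hom_span h B \<Longrightarrow> y \<in> hom_span h B \<Longrightarrow> x * y \<in> hom_span h B"
  by (rule hom_span_mult_mult) (auto simp: subalg_gens_def)

lemma subalg_gens_one: "subalg_gens h B \<Longrightarrow> 1 \<in> hom_span h B"
  by (simp add: subalg_gens_def)

lemma subalg_gens_hom: "subalg_gens h B \<Longrightarrow> h r \<in> hom_span h B"
  using hom_span_scale[OF subalg_gens_one, of B r] by simp

text \<open>The determinant trick: multiplication by \<open>x\<close> acts on the generators through
  a matrix \<open>M\<close> over the coefficient ring. The vector of generators is an eigenvector
  for \<open>x\<close>, nonzero because 1 is a combination of its entries, so the monic
  characteristic polynomial of \<open>M\<close> has the root \<open>x\<close>.\<close>

lemma hom_span_integral: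
  assumes fin: "finite B" and 1: "1 \<in> hom_span h B"
    and xB: "\<And>b. b \<in> B \<Longrightarrow> x * b \<in> hom_span h B"
  shows "\<exists>p. lead_coeff p = 1 \<and> degree p = card B \<and> poly (map_poly h p) x = 0"
proof -
  define n where "n = card B"
  obtain e where e: "bij_betw e {0..<n} B"
    using ex_bij_betw_nat_finite[OF fin] by (auto simp: n_def)
  have sumB: "(\<Sum>b\<in>B. g b) = (\<Sum>i\<in>{0..<n}. g (e i))" for g :: "complex \<Rightarrow> complex"
    by (rule sum.reindex_bij_betw[OF e, symmetric])
  have "\<forall>b\<in>B. \<exists>c. x * b = (\<Sum>b'\<in>B. h (c b') * b')"
    using xB by (auto simp: hom_span_def)
  then obtain c where c: "\<And>b. b \<in> B \<Longrightarrow> x * b = (\<Sum>b'\<in>B. h (c b b') * b')" by metis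
  define M where "M = mat n n (\<lambda>(i, j). c (e i) (e j))"
  have M: "M \<in> carrier_mat n n" by (simp add: M_def)
  define v where "v = vec n e"
  have eB: "e i \<in> B" if "i < n" for i using e that by (auto simp: bij_betw_def)
  have "map_mat h M *\<^sub>v v = x \<cdot>\<^sub>v v"
  proof (rule eq_vecI)
    fix i assume "i < dim_vec (x \<cdot>\<^sub>v v)"
    hence i: "i < n" by (simp add: v_def)
    have "(map_mat h M *\<^sub>v v) $ i = (\<Sum>j\<in>{0..<n}. h (c (e i) (e j)) * e j)"
      using i by (simp add: M_def v_def scalar_prod_def)
    also have "\<dots> = x * e i" using c[OF eB[OF i]] by (simp add: sumB)
    finally show "(map_mat h M *\<^sub>v v) $ i = (x \<cdot>\<^sub>v v) $ i" using i by (simp add: v_def)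
  qed (simp add: M_def v_def)
  moreover have "v \<noteq> 0\<^sub>v n"
  proof
    assume "v = 0\<^sub>v n"
    hence "e i = 0" if "i < n" for i
      using that by (metis index_vec index_zero_vec(1) v_def)
    moreover obtain d where "1 = (\<Sum>b\<in>B. h (d b) * b)" using 1 by (auto simp: hom_span_def)
    ultimately have "(1 :: complex) = 0" by (simp add: sumB)
    thus False by simp
  qed
  ultimately have "eigenvector (map_mat h M) v x"
    by (auto simp: eigenvector_def v_def M_def)
  hence "eigenvalue (map_mat h M) x" by (auto simp: eigenvalue_def)
  hence "poly (char_poly (map_mat h M)) x = 0"
    using eigenvalue_root_char_poly[of "map_mat h M" n x] M by simp
  hence "poly (map_poly h (char_poly M)) x = 0" by (simp add: char_poly_hom[OF M])
  thus ?thesis using degree_monic_char_poly[OF M] by (intro exI[of _ "char_poly M"]) (auto simp: n_def)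
qed

lemma subalg_gens_integral:
  assumes "subalg_gens h B" "x \<in> hom_span h B"
  shows "\<exists>p. lead_coeff p = 1 \<and> degree p = card B \<and> poly (map_poly h p) x = 0"
proof (rule hom_span_integral)
  show "finite B" "1 \<in> hom_span h B" using assms by (auto simp: subalg_gens_def)
  thus "x * b \<in> hom_span h B" if "b \<in> B" for b
    using assms that by (intro subalg_gens_mult[OF assms(1)] hom_span_base[of B b])
qed

text \<open>Products of generators generate the compositum, so the bounds for the degrees
  multiply.\<close>

lemma subalg_gens_times:
  assumes B: "subalg_gens h B" and C: "subalg_gens h C"
  defines "BC \<equiv> (\<lambda>(x, y). x * y) ` (B \<times> C)"
  shows "subalg_gens h BC" "card BC \<le> card B * card C" "hom_span h B \<subseteq> hom_span h BC"
    "hom_span h C \<subseteq> hom_span h BC"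
proof -
  have fin: "finite B" "finite C" using B C by (auto simp: subalg_gens_def)
  hence finBC: "finite BC" by (simp add: BC_def)
  show "card BC \<le> card B * card C" unfolding BC_def
    using card_image_le[of "B \<times> C" "\<lambda>(x, y). x * y"] fin by (simp add: card_cartesian_product)
  have *: "x * y \<in> hom_span h BC" if "x \<in> hom_span h B" "y \<in> hom_span h C" for x y
    using that by (rule hom_span_mult_mult) (auto simp: BC_def intro!: hom_span_base fin)
  show "hom_span h B \<subseteq> hom_span h BC" using *[OF _ subalg_gens_one[OF C]] by auto
  show "hom_span h C \<subseteq> hom_span h BC" using *[OF subalg_gens_one[OF B]] by auto
  have "x * y \<in> hom_span h BC" if "x \<in> BC" "y \<in> BC" for x y
  proof -
    obtain b c b' c' where "x = b * c" "y = b' * c'" "b \<in> B" "b' \<in> B" "c \<in> C" "c' \<in> C"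
      using \<open>x \<in> BC\<close> \<open>y \<in> BC\<close> by (auto simp: BC_def)
    thus ?thesis using *[of "b * b'" "c * c'"] B C by (auto simp: subalg_gens_def mult_ac)
  qed
  thus "subalg_gens h BC"
    using *[OF subalg_gens_one[OF B] subalg_gens_one[OF C]] finBC by (simp add: subalg_gens_def)
qed

text \<open>The monic relation rewrites \<open>y ^ degree p\<close> by lower powers, hence by
  induction every higher power too. Powers of \<open>y\<close> may coincide, which is why the
  cardinality is only bounded.\<close>

lemma subalg_gens_root:
  assumes p: "lead_coeff p = 1" "poly (map_poly h p) y = 0"
  defines "B \<equiv> (\<lambda>i. y ^ i) ` {..<degree p}"
  shows "subalg_gens h B" "card B \<le> degree p" "y \<in> hom_span h B"
proof -
  let ?m = "degree p"
  have fin: "finite B" by (simp add: B_def)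
  show "card B \<le> ?m" unfolding B_def using card_image_le[of "{..<?m}"] by fastforce
  have "poly (map_poly h p) y = (\<Sum>i\<le>degree (map_poly h p). h (coeff p i) * y ^ i)"
    by (simp add: poly_altdef coeff_map_poly)
  also have "degree (map_poly h p) = ?m"
    by (rule degree_map_poly) (use p(1) in auto)
  finally have "(\<Sum>i<?m. h (coeff p i) * y ^ i) + y ^ ?m = 0"
    unfolding lessThan_Suc_atMost[symmetric] sum.lessThan_Suc using p by simp
  hence ym: "y ^ ?m = (\<Sum>i<?m. h (- coeff p i) * y ^ i)"
    unfolding hom_uminus minus_mult_left[symmetric] sum_negf by (simp add: eq_neg_iff_add_eq_0 add.commute)
  have pow: "y ^ k \<in> hom_span h B" for k
  proof (induction k rule: less_induct)
    case (less k)
    show ?case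
    proof (cases "k < ?m")
      case True
      thus ?thesis by (intro hom_span_base fin) (auto simp: B_def)
    next
      case False
      hence "y ^ k = y ^ (k - ?m) * y ^ ?m" by (simp add: power_add[symmetric])
      also have "\<dots> = (\<Sum>i<?m. h (- coeff p i) * y ^ (k - ?m + i))"
        unfolding ym by (simp add: sum_distrib_left power_add mult_ac)
      also have "\<dots> \<in> hom_span h B"
        using False by (intro hom_span_sum hom_span_scale less) auto
      finally show ?thesis .
    qed
  qed
  show "y \<in> hom_span h B" using pow[of 1] by simp
  show "subalg_gens h B" using pow[of 0] pow fin
    by (auto simp: subalg_gens_def B_def power_add[symmetric])
qed

end

section \<open>Closure properties of algebraic integers and algebraic numbers\<close>

lemma comm_ring_hom_of_int_complex: "comm_ring_hom (of_int :: int \<Rightarrow> complex)" ..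
lemma comm_ring_hom_of_rat_complex: "comm_ring_hom (of_rat :: rat \<Rightarrow> complex)" ..

lemma algebraic_int_iff_monic:
  "algebraic_int (x :: complex) \<longleftrightarrow> (\<exists>p. lead_coeff p = 1 \<and> poly (map_poly of_int p) x = 0)"
  unfolding algebraic_int_altdef_ipoly by auto

lemma algebraic_int_subalg_gens:
  assumes "algebraic_int x" "algebraic_int y"
  obtains B where "subalg_gens (of_int :: int \<Rightarrow> complex) B" "x \<in> hom_span of_int B" "y \<in> hom_span of_int B"
proof -
  obtain p q where "lead_coeff p = (1 :: int)" "poly (map_poly of_int p) x = 0"
    "lead_coeff q = (1 :: int)" "poly (map_poly of_int q) y = 0"
    using assms by (auto simp: algebraic_int_iff_monic)
  note P = subalg_gens_root[OF comm_ring_hom_of_int_complex this(1,2)]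
    and Q = subalg_gens_root[OF comm_ring_hom_of_int_complex this(3,4)]
  note T = subalg_gens_times[OF comm_ring_hom_of_int_complex P(1) Q(1)]
  from that[OF T(1)] T(3,4) P(3) Q(3) show ?thesis by blast
qed

lemma subalg_gens_int_imp_algebraic_int:
  "subalg_gens (of_int :: int \<Rightarrow> complex) B \<Longrightarrow> x \<in> hom_span of_int B \<Longrightarrow> algebraic_int x"
  using subalg_gens_integral[OF comm_ring_hom_of_int_complex] by (auto simp: algebraic_int_iff_monic)

lemma algebraic_int_add:
  assumes "algebraic_int x" "algebraic_int y"
  shows "algebraic_int (x + y :: complex)"
proof -
  obtain B where B: "subalg_gens (of_int :: int \<Rightarrow> complex) B"
    "x \<in> hom_span of_int B" "y \<in> hom_span of_int B"
    using algebraic_int_subalg_gens[OF assms] .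
  show ?thesis using B(1) hom_span_add[OF comm_ring_hom_of_int_complex B(2,3)]
    by (rule subalg_gens_int_imp_algebraic_int)
qed

lemma algebraic_int_mult:
  assumes "algebraic_int x" "algebraic_int y"
  shows "algebraic_int (x * y :: complex)"
proof -
  obtain B where B: "subalg_gens (of_int :: int \<Rightarrow> complex) B"
    "x \<in> hom_span of_int B" "y \<in> hom_span of_int B"
    using algebraic_int_subalg_gens[OF assms] .
  show ?thesis using B(1) subalg_gens_mult[OF comm_ring_hom_of_int_complex B]
    by (rule subalg_gens_int_imp_algebraic_int)
qed

lemma algebraic_int_sum:
  "(\<And>i. i \<in> I \<Longrightarrow> algebraic_int (f i)) \<Longrightarrow> algebraic_int (sum f I :: complex)"
  by (induction I rule: infinite_finite_induct) (auto intro: algebraic_int_add)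

lemma algebraic_int_1: "algebraic_int (1 :: complex)"
  by (rule int_imp_algebraic_int) auto

lemma algebraic_int_prod:
  "(\<And>i. i \<in> I \<Longrightarrow> algebraic_int (f i)) \<Longrightarrow> algebraic_int (prod f I :: complex)"
  by (induction I rule: infinite_finite_induct) (auto intro: algebraic_int_mult algebraic_int_1)

lemma algebraic_iff_monic:
  "algebraic (x :: complex) \<longleftrightarrow> (\<exists>p. lead_coeff p = 1 \<and> poly (map_poly of_rat p) x = 0)"
proof
  assume "algebraic x"
  then obtain P where P: "\<And>i. coeff P i \<in> \<rat>" "P \<noteq> 0" "poly P x = 0"
    unfolding algebraic_altdef by blast
  obtain q where q: "P = map_poly of_rat q"
    using ratpolyE[of P] P(1) by blast
  have "q \<noteq> 0" using P(2) q by auto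
  hence "lead_coeff (Polynomial.smult (inverse (lead_coeff q)) q) = 1" by simp
  moreover have "poly (map_poly of_rat (Polynomial.smult (inverse (lead_coeff q)) q)) x = 0"
    using P(3) by (simp add: q of_rat_hom.map_poly_hom_smult)
  ultimately show "\<exists>p. lead_coeff p = 1 \<and> poly (map_poly of_rat p) x = 0" by blast
next
  assume "\<exists>p. lead_coeff p = 1 \<and> poly (map_poly of_rat p) x = 0"
  then obtain p where "lead_coeff p = 1" "poly (map_poly of_rat p) x = 0" by blast
  thus "algebraic x"
    by (intro algebraicI'[of "map_poly of_rat p"]) (auto simp: coeff_map_poly)
qed

lemma algebraic_subalg_gens:
  assumes "algebraic x" "algebraic y"
  obtains B where "subalg_gens (of_rat :: rat \<Rightarrow> complex) B" "x \<in> hom_span of_rat B" "y \<in> hom_span of_rat B"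
proof -
  obtain p q where "lead_coeff p = (1 :: rat)" "poly (map_poly of_rat p) x = 0"
    "lead_coeff q = (1 :: rat)" "poly (map_poly of_rat q) y = 0"
    using assms by (auto simp: algebraic_iff_monic)
  note P = subalg_gens_root[OF comm_ring_hom_of_rat_complex this(1,2)]
    and Q = subalg_gens_root[OF comm_ring_hom_of_rat_complex this(3,4)]
  note T = subalg_gens_times[OF comm_ring_hom_of_rat_complex P(1) Q(1)]
  from that[OF T(1)] T(3,4) P(3) Q(3) show ?thesis by blast
qed

lemma subalg_gens_rat_imp_algebraic:
  "subalg_gens (of_rat :: rat \<Rightarrow> complex) B \<Longrightarrow> x \<in> hom_span of_rat B \<Longrightarrow> algebraic x"
  using subalg_gens_integral[OF comm_ring_hom_of_rat_complex] by (auto simp: algebraic_iff_monic)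

lemma algebraic_add:
  assumes "algebraic x" "algebraic y"
  shows "algebraic (x + y :: complex)"
proof -
  obtain B where B: "subalg_gens (of_rat :: rat \<Rightarrow> complex) B"
    "x \<in> hom_span of_rat B" "y \<in> hom_span of_rat B"
    using algebraic_subalg_gens[OF assms] .
  show ?thesis using B(1) hom_span_add[OF comm_ring_hom_of_rat_complex B(2,3)]
    by (rule subalg_gens_rat_imp_algebraic)
qed

lemma algebraic_mult:
  assumes "algebraic x" "algebraic y"
  shows "algebraic (x * y :: complex)"
proof -
  obtain B where B: "subalg_gens (of_rat :: rat \<Rightarrow> complex) B"
    "x \<in> hom_span of_rat B" "y \<in> hom_span of_rat B"
    using algebraic_subalg_gens[OF assms] .
  show ?thesis using B(1) subalg_gens_mult[OF comm_ring_hom_of_rat_complex B]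
    by (rule subalg_gens_rat_imp_algebraic)
qed

lemma algebraic_power: "algebraic (x :: complex) \<Longrightarrow> algebraic (x ^ n)"
  by (induction n) (auto intro: algebraic_mult rat_imp_algebraic)

lemma algebraic_sum:
  "(\<And>i. i \<in> I \<Longrightarrow> algebraic (f i)) \<Longrightarrow> algebraic (sum f I :: complex)"
  by (induction I rule: infinite_finite_induct) (auto intro: algebraic_add)

section \<open>Embeddings, conjugates and the house\<close>

text \<open>
  Being closed under inverses is automatic for a ring of algebraic numbers that contains the
  rationals; see \<open>alg_field_inverse\<close>.
\<close>

definition alg_field :: "complex set \<Rightarrow> bool" where
  "alg_field F \<longleftrightarrow> \<rat> \<subseteq> F \<and> (\<forall>x\<in>F. \<forall>y\<in>F. x + y \<in> F \<and> x * y \<in> F) \<and> (\<forall>x\<in>F. algebraic x)"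

text \<open>The function is total, but the conditions only see its values on \<open>F\<close> and on
  the rationals; this lets an extension be a new function that agrees with the old one on the
  smaller field.\<close>

definition emb :: "complex set \<Rightarrow> (complex \<Rightarrow> complex) \<Rightarrow> bool" where
  "emb F \<sigma> \<longleftrightarrow> (\<forall>x\<in>F. \<forall>y\<in>F. \<sigma> (x + y) = \<sigma> x + \<sigma> y \<and> \<sigma> (x * y) = \<sigma> x * \<sigma> y) \<and> (\<forall>x\<in>\<rat>. \<sigma> x = x)"

definition coeffs_in :: "complex set \<Rightarrow> complex poly \<Rightarrow> bool" where
  "coeffs_in F f \<longleftrightarrow> (\<forall>i. coeff f i \<in> F)"

context
  fixes F assumes F: "alg_field F"
begin

lemma alg_field_rat: "x \<in> \<rat> \<Longrightarrow> x \<in> F"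
  and alg_field_add: "x \<in> F \<Longrightarrow> y \<in> F \<Longrightarrow> x + y \<in> F"
  and alg_field_mult: "x \<in> F \<Longrightarrow> y \<in> F \<Longrightarrow> x * y \<in> F"
  and alg_field_algebraic: "x \<in> F \<Longrightarrow> algebraic x"
  using F by (auto simp: alg_field_def)

lemma alg_field_uminus: "x \<in> F \<Longrightarrow> - x \<in> F"
  using alg_field_mult[OF alg_field_rat, of "-1" x] by simp

lemma alg_field_diff: "x \<in> F \<Longrightarrow> y \<in> F \<Longrightarrow> x - y \<in> F"
  using alg_field_add[of x "- y"] alg_field_uminus by simp

lemma alg_field_sum: "(\<And>i. i \<in> I \<Longrightarrow> f i \<in> F) \<Longrightarrow> sum f I \<in> F"
  by (induction I rule: infinite_finite_induct) (auto intro: alg_field_rat alg_field_add)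

lemma alg_field_prod: "(\<And>i. i \<in> I \<Longrightarrow> f i \<in> F) \<Longrightarrow> prod f I \<in> F"
  by (induction I rule: infinite_finite_induct) (auto intro: alg_field_rat alg_field_mult)

lemma alg_field_power: "x \<in> F \<Longrightarrow> x ^ n \<in> F"
  by (induction n) (auto intro: alg_field_rat alg_field_mult)

lemma alg_field_poly: "coeffs_in F f \<Longrightarrow> x \<in> F \<Longrightarrow> poly f x \<in> F"
  by (auto simp: poly_altdef coeffs_in_def intro!: alg_field_sum alg_field_mult alg_field_power)

text \<open>A nonzero algebraic \<open>x\<close> satisfies \<open>a + x * poly q x = 0\<close> with
  rational coefficients and \<open>a \<noteq> 0\<close>, so its inverse is a polynomial in
  \<open>x\<close>.\<close>

lemma alg_field_inverse:
  assumes x: "x \<in> F"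
  shows "inverse x \<in> F"
proof (cases "x = 0")
  case False
  obtain p' where p': "poly (map_poly of_int p') x = 0" "coeff p' 0 \<noteq> 0"
    using algebraicE'_nonzero[OF alg_field_algebraic[OF x] False] by metis
  define p :: "complex poly" where "p = map_poly of_int p'"
  have p: "\<And>i. coeff p i \<in> \<rat>" "poly p x = 0" "coeff p 0 \<noteq> 0"
    using p' by (auto simp: p_def coeff_map_poly)
  obtain a q where pq: "p = pCons a q" by (cases p)
  have a: "a \<noteq> 0" "a \<in> \<rat>" using p(3) p(1)[of 0] by (auto simp: pq)
  have q: "coeffs_in F q" using p(1)[of "Suc _"] by (auto simp: pq coeffs_in_def intro: alg_field_rat)
  have "a + x * poly q x = 0" using p(2) by (simp add: pq)
  hence "inverse x = - inverse a * poly q x" using a False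
    by (simp add: field_simps eq_neg_iff_add_eq_0)
  also have "\<dots> \<in> F" using a by (intro alg_field_mult alg_field_poly q x alg_field_rat) auto
  finally show ?thesis .
qed (auto intro: alg_field_rat)

lemma coeffs_in_add: "coeffs_in F f \<Longrightarrow> coeffs_in F g \<Longrightarrow> coeffs_in F (f + g)"
  and coeffs_in_diff: "coeffs_in F f \<Longrightarrow> coeffs_in F g \<Longrightarrow> coeffs_in F (f - g)"
  and coeffs_in_mult: "coeffs_in F f \<Longrightarrow> coeffs_in F g \<Longrightarrow> coeffs_in F (f * g)"
  and coeffs_in_monom: "c \<in> F \<Longrightarrow> coeffs_in F (monom c n)"
  by (auto simp: coeffs_in_def coeff_mult intro!: alg_field_add alg_field_diff alg_field_mult alg_field_sum
      intro: alg_field_rat)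

context
  fixes \<sigma> assumes \<sigma>: "emb F \<sigma>"
begin

lemma emb_rat: "x \<in> \<rat> \<Longrightarrow> \<sigma> x = x"
  and emb_add: "x \<in> F \<Longrightarrow> y \<in> F \<Longrightarrow> \<sigma> (x + y) = \<sigma> x + \<sigma> y"
  and emb_mult: "x \<in> F \<Longrightarrow> y \<in> F \<Longrightarrow> \<sigma> (x * y) = \<sigma> x * \<sigma> y"
  using \<sigma> by (auto simp: emb_def)

lemma emb_0: "\<sigma> 0 = 0" and emb_1: "\<sigma> 1 = 1"
  by (auto intro: emb_rat)

lemma emb_diff: "x \<in> F \<Longrightarrow> y \<in> F \<Longrightarrow> \<sigma> (x - y) = \<sigma> x - \<sigma> y"
  using emb_add[of "x - y" y] by (simp add: alg_field_diff)

lemma emb_sum: "(\<And>i. i \<in> I \<Longrightarrow> f i \<in> F) \<Longrightarrow> \<sigma> (sum f I) = (\<Sum>i\<in>I. \<sigma> (f i))"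
  by (induction I rule: infinite_finite_induct) (auto simp: emb_0 emb_add alg_field_sum)

lemma emb_prod: "(\<And>i. i \<in> I \<Longrightarrow> f i \<in> F) \<Longrightarrow> \<sigma> (prod f I) = (\<Prod>i\<in>I. \<sigma> (f i))"
  by (induction I rule: infinite_finite_induct) (auto simp: emb_1 emb_mult alg_field_prod)

lemma emb_power: "x \<in> F \<Longrightarrow> \<sigma> (x ^ n) = \<sigma> x ^ n"
  by (induction n) (auto simp: emb_1 emb_mult alg_field_power)

lemma emb_nonzero: "x \<in> F \<Longrightarrow> x \<noteq> 0 \<Longrightarrow> \<sigma> x \<noteq> 0"
  using emb_mult[of x "inverse x"] by (auto simp: alg_field_inverse emb_1)

lemma map_poly_emb_add:
  "coeffs_in F f \<Longrightarrow> coeffs_in F g \<Longrightarrow> map_poly \<sigma> (f + g) = map_poly \<sigma> f + map_poly \<sigma> g"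
  by (intro poly_eqI) (simp add: coeff_map_poly emb_0 emb_add coeffs_in_def)

lemma map_poly_emb_diff:
  "coeffs_in F f \<Longrightarrow> coeffs_in F g \<Longrightarrow> map_poly \<sigma> (f - g) = map_poly \<sigma> f - map_poly \<sigma> g"
  by (intro poly_eqI) (simp add: coeff_map_poly emb_0 emb_diff coeffs_in_def)

lemma map_poly_emb_mult:
  "coeffs_in F f \<Longrightarrow> coeffs_in F g \<Longrightarrow> map_poly \<sigma> (f * g) = map_poly \<sigma> f * map_poly \<sigma> g"
  by (intro poly_eqI) (simp add: coeff_map_poly emb_0 emb_sum emb_mult coeffs_in_def coeff_mult alg_field_mult)

lemma emb_poly: "coeffs_in F f \<Longrightarrow> x \<in> F \<Longrightarrow> \<sigma> (poly f x) = poly (map_poly \<sigma> f) (\<sigma> x)"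
proof -
  assume f: "coeffs_in F f" and x: "x \<in> F"
  have "poly (map_poly \<sigma> f) (\<sigma> x) = (\<Sum>i\<le>degree f. coeff (map_poly \<sigma> f) i * \<sigma> x ^ i)"
    unfolding poly_altdef
    by (rule sum.mono_neutral_left) (auto simp: degree_map_poly_le coeff_eq_0 not_le)
  also have "\<dots> = \<sigma> (poly f x)" using f x
    by (simp add: poly_altdef coeff_map_poly emb_0 emb_sum emb_mult emb_power alg_field_mult
        alg_field_power coeffs_in_def)
  finally show ?thesis by simp
qed

lemma emb_root_rat:
  assumes x: "x \<in> F" and p: "poly (map_poly of_rat p) x = 0"
  shows "poly (map_poly of_rat p) (\<sigma> x) = 0"
proof -
  have "\<sigma> (poly (map_poly of_rat p) x) = poly (map_poly \<sigma> (map_poly of_rat p)) (\<sigma> x)"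
    by (rule emb_poly[OF _ x]) (auto simp: coeffs_in_def coeff_map_poly intro: alg_field_rat)
  also have "map_poly \<sigma> (map_poly of_rat p) = map_poly of_rat p"
    by (intro poly_eqI) (simp add: coeff_map_poly emb_0 emb_rat)
  finally show ?thesis using p by (simp add: emb_0)
qed

text \<open>The extension to the field generated by \<open>y\<close> sends \<open>poly f y\<close>
  to \<open>poly (map_poly \<sigma> f) y'\<close>. This is well defined once every \<open>f\<close>
  over \<open>F\<close> that vanishes at \<open>y\<close> has an image vanishing at
  \<open>y'\<close>, which holds because \<open>p\<close> divides \<open>f\<close>.\<close>

lemma emb_extend:
  assumes p: "coeffs_in F p" "p \<noteq> 0" "poly p y = 0"
    and min: "\<And>q. coeffs_in F q \<Longrightarrow> q \<noteq> 0 \<Longrightarrow> poly q y = 0 \<Longrightarrow> degree p \<le> degree q"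
    and y': "poly (map_poly \<sigma> p) y' = 0" and y: "algebraic y"
  obtains F' \<sigma>' where "alg_field F'" "emb F' \<sigma>'" "F \<subseteq> F'" "y \<in> F'" "\<sigma>' y = y'"
    "\<And>x. x \<in> F \<Longrightarrow> \<sigma>' x = \<sigma> x"
proof -
  \<comment> \<open>Division by \<open>p\<close>, one leading term at a time, with all coefficients
    kept in \<open>F\<close>. Each subtraction of \<open>m * p\<close> preserves the values at
    \<open>y\<close> and \<open>y'\<close> in question, and minimality of \<open>p\<close>
    guarantees that the division never gets stuck.\<close>
  have root: "poly (map_poly \<sigma> f) y' = 0" if "coeffs_in F f" "poly f y = 0" for f
    using that
  proof (induction "degree f" arbitrary: f rule: less_induct)
    case less
    show ?case
    proof (cases "f = 0")
      case False
      have dle: "degree p \<le> degree f" using min less.prems False by blast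
      define m where "m = monom (lead_coeff f * inverse (lead_coeff p)) (degree f - degree p)"
      have m: "coeffs_in F m" unfolding m_def using less.prems p
        by (intro coeffs_in_monom alg_field_mult alg_field_inverse) (auto simp: coeffs_in_def)
      have mp: "coeffs_in F (m * p)" by (intro coeffs_in_mult m p)
      have sub: "poly (map_poly \<sigma> f) y' = poly (map_poly \<sigma> (f - m * p)) y'"
        using less.prems p m y' by (simp add: map_poly_emb_diff map_poly_emb_mult mp)
      have "m \<noteq> 0" using False p by (simp add: m_def)
      moreover have "degree m = degree f - degree p"
        unfolding m_def by (rule degree_monom_eq) (use False p in simp)
      ultimately have deg: "degree (m * p) = degree f" using p dle
        by (simp add: degree_mult_eq)
      have lc: "lead_coeff (m * p) = lead_coeff f"
        unfolding lead_coeff_mult m_def lead_coeff_monom using p by simp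
      show ?thesis
      proof (cases "f - m * p = 0")
        case True
        thus ?thesis using sub by simp
      next
        case False
        have "degree (f - m * p) < degree f"
          using deg lc False by (metis coeff_diff degree_diff_le diff_self le_neq_implies_less
            leading_coeff_0_iff order_refl)
        hence "poly (map_poly \<sigma> (f - m * p)) y' = 0"
          using less.prems p by (intro less.hyps coeffs_in_diff mp) auto
        thus ?thesis using sub by simp
      qed
    qed simp
  qed
  define F' where "F' = {poly f y | f. coeffs_in F f}"
  define \<sigma>' where "\<sigma>' z = poly (map_poly \<sigma> (SOME f. coeffs_in F f \<and> poly f y = z)) y'" for z
  \<comment> \<open>The polynomial chosen in \<open>\<sigma>'\<close> does not matter, since two
    polynomials with the same value at \<open>y\<close> have images with the same value at
    \<open>y'\<close>.\<close>
  have ev: "\<sigma>' (poly f y) = poly (map_poly \<sigma> f) y'" if f: "coeffs_in F f" for f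
  proof -
    define g where "g = (SOME g. coeffs_in F g \<and> poly g y = poly f y)"
    have g: "coeffs_in F g \<and> poly g y = poly f y" unfolding g_def
      by (rule someI[of _ f]) (use f in simp)
    have "poly (map_poly \<sigma> (g - f)) y' = 0" using f g by (intro root coeffs_in_diff) auto
    thus ?thesis using f g by (simp add: map_poly_emb_diff \<sigma>'_def g_def)
  qed
  have const: "coeffs_in F [:c:]" if "c \<in> F" for c
    using coeffs_in_monom[OF that, of 0] by (simp add: monom_0)
  have sub: "F \<subseteq> F'" unfolding F'_def
    using const by (force intro: exI[of _ "[:_:]"])
  have X: "coeffs_in F [:0, 1:]"
    using coeffs_in_monom[of 1 1] alg_field_rat[of 1] by (simp add: x_as_monom)
  show ?thesis
  proof (rule that[of F' \<sigma>'])
    show "y \<in> F'" unfolding F'_def using X by (auto intro!: exI[of _ "[:0, 1:]"])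
    show "\<sigma>' y = y'" using ev[OF X] by (simp add: map_poly_pCons emb_0 emb_1)
    show F\<sigma>: "\<sigma>' x = \<sigma> x" if "x \<in> F" for x using ev[OF const[OF that]]
      by (cases "x = 0") (simp_all add: map_poly_pCons emb_0)
    show "F \<subseteq> F'" by (rule sub)
    show "emb F' \<sigma>'" unfolding emb_def
    proof safe
      fix u v assume "u \<in> F'" "v \<in> F'"
      then obtain f g where fg: "coeffs_in F f" "coeffs_in F g" "u = poly f y" "v = poly g y"
        by (auto simp: F'_def)
      show "\<sigma>' (u + v) = \<sigma>' u + \<sigma>' v"
        using ev[OF coeffs_in_add[OF fg(1,2)]] ev[OF fg(1)] ev[OF fg(2)] fg
        by (simp add: map_poly_emb_add)
      show "\<sigma>' (u * v) = \<sigma>' u * \<sigma>' v"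
        using ev[OF coeffs_in_mult[OF fg(1,2)]] ev[OF fg(1)] ev[OF fg(2)] fg
        by (simp add: map_poly_emb_mult)
    qed (simp add: F\<sigma> alg_field_rat emb_rat)
    show "alg_field F'" unfolding alg_field_def
    proof safe
      fix u v assume "u \<in> F'" "v \<in> F'"
      then obtain f g where fg: "coeffs_in F f" "coeffs_in F g" "u = poly f y" "v = poly g y"
        by (auto simp: F'_def)
      show "u + v \<in> F'" unfolding F'_def using fg
        by (auto intro!: exI[of _ "f + g"] coeffs_in_add)
      show "u * v \<in> F'" unfolding F'_def using fg
        by (auto intro!: exI[of _ "f * g"] coeffs_in_mult)
      show "algebraic u" using fg y unfolding fg(3) poly_altdef
        by (auto simp: coeffs_in_def intro!: algebraic_sum algebraic_mult algebraic_power
            intro: alg_field_algebraic)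
    next
      fix u :: complex assume "u \<in> \<rat>"
      thus "u \<in> F'" using sub alg_field_rat by blast
    qed
  qed
qed

end

end

section \<open>Minimal polynomials and embeddings onto prescribed conjugates\<close>

lemma min_poly_rat:
  assumes "algebraic x"
  shows "min_poly_rat x \<noteq> 0" "lead_coeff (min_poly_rat x) = 1"
    "poly (map_poly of_rat (min_poly_rat x)) x = 0"
    "q \<noteq> 0 \<Longrightarrow> poly (map_poly of_rat q) x = 0 \<Longrightarrow> degree (min_poly_rat x) \<le> degree q"
proof -
  let ?Q = "\<lambda>q. q \<noteq> 0 \<and> poly (map_poly of_rat q) x = 0"
  obtain p0 where "lead_coeff p0 = 1" "poly (map_poly of_rat p0) x = 0"
    using assms by (auto simp: algebraic_iff_monic)
  hence "?Q p0" by auto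
  then obtain p where p: "?Q p" "\<And>q. ?Q q \<Longrightarrow> degree p \<le> degree q"
    using ex_has_least_nat[of ?Q p0 degree] by blast
  define p1 where "p1 = Polynomial.smult (inverse (lead_coeff p)) p"
  have lc: "lead_coeff p \<noteq> 0" using p(1) by simp
  let ?R = "\<lambda>p. p \<noteq> 0 \<and> lead_coeff p = 1 \<and> poly (map_poly of_rat p) x = 0 \<and>
      (\<forall>q. q \<noteq> 0 \<and> poly (map_poly of_rat q) x = 0 \<longrightarrow> degree p \<le> degree q)"
  have "?R p1"
  proof (intro conjI allI impI)
    show "p1 \<noteq> 0" "lead_coeff p1 = 1" using lc by (simp_all add: p1_def)
    show "poly (map_poly of_rat p1) x = 0"
      using p(1) by (simp add: p1_def of_rat_hom.map_poly_hom_smult)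
    show "degree p1 \<le> degree q" if "?Q q" for q
      using p(2)[OF that] lc by (simp add: p1_def)
  qed
  hence R: "?R (min_poly_rat x)" unfolding min_poly_rat_def by (rule someI[of ?R])
  show "min_poly_rat x \<noteq> 0" using R by (rule conjunct1)
  show "lead_coeff (min_poly_rat x) = 1" using R by (elim conjE)
  show "poly (map_poly of_rat (min_poly_rat x)) x = 0" using R by (elim conjE)
  show "degree (min_poly_rat x) \<le> degree q" if "q \<noteq> 0" "poly (map_poly of_rat q) x = 0"
    using R that by (elim conjE allE[of _ q]) simp
qed

text \<open>The image of a minimal polynomial of \<open>y\<close> over \<open>F\<close> has a
  complex root by the fundamental theorem of algebra, and any root serves as the image of
  \<open>y\<close>.\<close>

lemma emb_extend_algebraic:
  assumes F: "alg_field F" and \<sigma>: "emb F \<sigma>" and y: "algebraic y"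
  obtains F' \<sigma>' where "alg_field F'" "emb F' \<sigma>'" "F \<subseteq> F'" "y \<in> F'"
    "\<And>x. x \<in> F \<Longrightarrow> \<sigma>' x = \<sigma> x"
proof -
  let ?Q = "\<lambda>q. coeffs_in F q \<and> q \<noteq> 0 \<and> poly q y = 0"
  obtain p0 where "\<And>i. coeff p0 i \<in> \<rat>" "p0 \<noteq> 0" "poly p0 y = 0"
    using y unfolding algebraic_altdef by blast
  hence "?Q p0" by (auto simp: coeffs_in_def intro: alg_field_rat[OF F])
  then obtain p where p: "?Q p" "\<And>q. ?Q q \<Longrightarrow> degree p \<le> degree q"
    using ex_has_least_nat[of ?Q p0 degree] by blast
  have lc: "\<sigma> (lead_coeff p) \<noteq> 0"
    using p by (intro emb_nonzero[OF F \<sigma>]) (auto simp: coeffs_in_def)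
  have "degree p > 0"
  proof (rule ccontr)
    assume "\<not> degree p > 0"
    then obtain c where "p = [:c:]" using degree_eq_zeroE[of p] by auto
    thus False using p by auto
  qed
  moreover have "degree (map_poly \<sigma> p) = degree p" by (rule degree_map_poly) (use lc p in auto)
  ultimately have "\<not> constant (poly (map_poly \<sigma> p))" by (simp add: constant_degree)
  then obtain y' where "poly (map_poly \<sigma> p) y' = 0"
    using fundamental_theorem_of_algebra by blast
  show ?thesis
  proof (rule emb_extend[OF F \<sigma> _ _ _ _ \<open>poly (map_poly \<sigma> p) y' = 0\<close> y])
    show "coeffs_in F p" "p \<noteq> 0" "poly p y = 0" using p(1) by auto
    show "degree p \<le> degree q" if "coeffs_in F q" "q \<noteq> 0" "poly q y = 0" for q
      using p(2)[of q] that by blast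
  next
    fix F' \<sigma>'
    assume "alg_field F'" "emb F' \<sigma>'" "F \<subseteq> F'" "y \<in> F'" "\<And>x. x \<in> F \<Longrightarrow> \<sigma>' x = \<sigma> x"
    thus ?thesis by (rule that)
  qed
qed

text \<open>To bound a conjugate of an expression built from several numbers, it must be seen as the
  image under one map that is defined on all of them. First \<open>x\<close> is sent to
  \<open>x'\<close> over the rationals, then the elements of \<open>Y\<close> are adjoined one by
  one.\<close>

lemma emb_conjugate:
  assumes x: "algebraic x" and x': "x' \<in> conjugates x"
    and Y: "finite Y" "\<And>y. y \<in> Y \<Longrightarrow> algebraic y"
  obtains F \<sigma> where "alg_field F" "emb F \<sigma>" "x \<in> F" "Y \<subseteq> F" "\<sigma> x = x'"
proof -
  have "\<exists>F \<sigma>. alg_field F \<and> emb F \<sigma> \<and> x \<in> F \<and> Y \<subseteq> F \<and> \<sigma> x = x'"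
    using Y
  proof (induction Y rule: finite_induct)
    case empty
    have Q: "alg_field \<rat>" "emb \<rat> id" by (auto simp: alg_field_def emb_def intro: rat_imp_algebraic)
    let ?p = "map_poly of_rat (min_poly_rat x) :: complex poly"
    obtain F \<sigma> where "alg_field F" "emb F \<sigma>" "x \<in> F" "\<sigma> x = x'"
    proof (rule emb_extend[OF Q, of ?p x x'])
      show "coeffs_in \<rat> ?p" by (auto simp: coeffs_in_def coeff_map_poly)
      show "?p \<noteq> 0" "poly ?p x = 0" using min_poly_rat[OF x] by auto
      show "poly (map_poly id ?p) x' = 0" using x' by (simp add: conjugates_def map_poly_id)
      fix q assume q: "coeffs_in \<rat> q" "q \<noteq> 0" "poly q x = 0"
      then obtain r where r: "q = map_poly of_rat r" using ratpolyE[of q] by (auto simp: coeffs_in_def)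
      show "degree ?p \<le> degree q" using min_poly_rat(4)[OF x, of r] q by (auto simp: r)
    qed (use x in auto)
    thus ?case by blast
  next
    case (insert y Y)
    then obtain F \<sigma> where F: "alg_field F" "emb F \<sigma>" "x \<in> F" "Y \<subseteq> F" "\<sigma> x = x'" by auto
    have "algebraic y" using insert.prems by simp
    then obtain F' \<sigma>' where F': "alg_field F'" "emb F' \<sigma>'" "F \<subseteq> F'" "y \<in> F'"
      "\<And>z. z \<in> F \<Longrightarrow> \<sigma>' z = \<sigma> z"
      using emb_extend_algebraic[OF F(1,2)] by metis
    have "x \<in> F' \<and> insert y Y \<subseteq> F' \<and> \<sigma>' x = x'" using F F'(3-5) by auto
    thus ?case using F'(1,2) by blast
  qed
  thus ?thesis using that by blast
qed

lemma finite_conjugates: "algebraic x \<Longrightarrow> finite (conjugates x)"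
  unfolding conjugates_def using min_poly_rat(1)[of x] by (intro poly_roots_finite) simp

lemma norm_conjugate_le_house: "algebraic x \<Longrightarrow> y \<in> conjugates x \<Longrightarrow> norm y \<le> house x"
  unfolding house_def by (intro Max_ge finite_imageI finite_conjugates) auto

lemma self_conjugate: "algebraic x \<Longrightarrow> x \<in> conjugates x"
  unfolding conjugates_def using min_poly_rat(3) by simp

text \<open>An embedding fixes the rational minimal polynomial and so permits only conjugates as
  values.\<close>

lemma norm_emb_le_house:
  assumes "alg_field F" "emb F \<sigma>" "x \<in> F"
  shows "norm (\<sigma> x) \<le> house x"
proof -
  have x: "algebraic x" using alg_field_algebraic[OF assms(1,3)] .
  show ?thesis using emb_root_rat[OF assms min_poly_rat(3)[OF x]]
    by (intro norm_conjugate_le_house x) (simp add: conjugates_def)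
qed

text \<open>Up to sign, the product of the roots of the minimal polynomial is its constant term.
  This is rational, an algebraic integer and nonzero, hence of absolute value at least 1. One factor
  is \<open>x\<close>; the others, at most \<open>m\<close> of them, are bounded by
  \<open>H\<close>.\<close>

lemma norm_conjugates_bound:
  assumes x: "algebraic_int x" "x \<noteq> 0" and H: "H \<ge> 1" "\<And>y. y \<in> conjugates x \<Longrightarrow> norm y \<le> H"
    and m: "degree (min_poly_rat x) \<le> Suc m"
  shows "1 \<le> norm x * H ^ m"
proof -
  have ax: "algebraic x" using x by auto
  let ?P = "map_poly of_rat (min_poly_rat x) :: complex poly"
  have P: "?P \<noteq> 0" "lead_coeff ?P = 1" using min_poly_rat[OF ax] by auto
  obtain p where p: "lead_coeff p = (1 :: int)" "poly (map_poly of_int p) x = 0"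
    using x(1) by (auto simp: algebraic_int_iff_monic)
  \<comment> \<open>A conjugate is an image under an embedding, so it inherits the monic integer
    equation of \<open>x\<close> and its nonvanishing.\<close>
  have r: "algebraic_int r" "r \<noteq> 0" if conj: "r \<in> conjugates x" for r
  proof -
    obtain F \<sigma> where F: "alg_field F" "emb F \<sigma>" "x \<in> F" "\<sigma> x = r"
      using emb_conjugate[OF ax conj, of "{}"] by auto
    show "r \<noteq> 0" using emb_nonzero[OF F(1-3) x(2)] F(4) by simp
    have eq: "map_poly of_rat (map_poly of_int p) = (map_poly of_int p :: complex poly)"
      by (intro poly_eqI) (simp add: coeff_map_poly)
    show "algebraic_int r"
      unfolding algebraic_int_iff_monic using p(1) emb_root_rat[OF F(1-3), of "map_poly of_int p"] F(4) p(2) by (auto simp: eq)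
  qed
  have roots: "r \<in># proots ?P \<longleftrightarrow> r \<in> conjugates x" for r
    using P by (simp add: conjugates_def set_count_proots)
  have "?P = (\<Prod>r\<in>#proots ?P. [:- r, 1:])"
    using complex_poly_decompose_multiset[of ?P] P(2) by simp
  hence "poly ?P 0 = poly (\<Prod>r\<in>#proots ?P. [:- r, 1:]) 0" by simp
  also have "\<dots> = (\<Prod>r\<in>#proots ?P. - r)"
    by (induction "proots ?P") (auto simp: poly_prod_mset image_mset.compositionality o_def)
  finally have P0: "poly ?P 0 = (\<Prod>r\<in>#proots ?P. - r)" .
  have prod_int: "algebraic_int (\<Prod>r\<in>#A. - r)" if "\<And>r. r \<in># A \<Longrightarrow> algebraic_int r" for A :: "complex multiset"
    using that by (induction A) (auto intro!: algebraic_int_1 algebraic_int_mult)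
  have "algebraic_int (poly ?P 0)" unfolding P0 by (intro prod_int r) (simp add: roots)
  moreover have "poly ?P 0 \<in> \<rat>" by (simp add: poly_0_coeff_0 coeff_map_poly)
  ultimately have "poly ?P 0 \<in> \<int>" by (intro rational_algebraic_int_is_int)
  moreover have "poly ?P 0 \<noteq> 0" using r(2)[of 0] by (auto simp: conjugates_def)
  moreover have "norm z \<ge> 1" if "z \<in> \<int>" "z \<noteq> 0" for z :: complex
    using that by (elim Ints_cases) auto
  ultimately have "norm (poly ?P 0) \<ge> 1" by blast
  also have "norm (poly ?P 0) = (\<Prod>r\<in>#proots ?P. norm r)"
  proof -
    have "norm (\<Prod>r\<in>#A. - r) = (\<Prod>r\<in>#A. norm r)" for A :: "complex multiset"
      by (induction A) (auto simp: norm_mult)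
    thus ?thesis unfolding P0 .
  qed
  finally have ge1: "1 \<le> (\<Prod>r\<in>#proots ?P. norm r)" .
  obtain A where A: "proots ?P = add_mset x A"
    using multi_member_split[OF iffD2[OF roots self_conjugate[OF ax]]] by auto
  have "(\<Prod>r\<in>#B. norm r) \<le> H ^ size B \<and> (\<Prod>r\<in>#B. norm r) \<ge> 0"
    if "\<And>r. r \<in># B \<Longrightarrow> norm r \<le> H" for B :: "complex multiset"
    using that H(1) by (induction B) (auto intro!: mult_mono)
  moreover have "norm r \<le> H" if "r \<in># A" for r
    using that H(2) roots[of r] by (simp add: A)
  ultimately have "(\<Prod>r\<in>#A. norm r) \<le> H ^ size A" by blast
  also have "size A \<le> m" using m size_proots_complex[of ?P] by (simp add: A)
  hence "H ^ size A \<le> H ^ m" using H(1) by (rule power_increasing)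
  finally have "norm x * (\<Prod>r\<in>#A. norm r) \<le> norm x * H ^ m"
    by (simp add: mult_left_mono)
  moreover have "(\<Prod>r\<in>#proots ?P. norm r) = norm x * (\<Prod>r\<in>#A. norm r)" by (simp add: A)
  ultimately show ?thesis using ge1 by linarith
qed

text \<open>If all conjugates were smaller than 1, then \<open>H = 1\<close> in
  \<open>norm_conjugates_bound\<close> would give \<open>norm x \<ge> 1\<close>.\<close>

lemma house_ge_1: "algebraic_int x \<Longrightarrow> x \<noteq> 0 \<Longrightarrow> house x \<ge> 1"
proof (rule ccontr)
  assume x: "algebraic_int x" "x \<noteq> 0" and "\<not> house x \<ge> 1"
  hence less: "norm y < 1" if "y \<in> conjugates x" for y
    using norm_conjugate_le_house[of x y] that by auto
  have "1 \<le> norm x * 1 ^ degree (min_poly_rat x)"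
    using x less by (intro norm_conjugates_bound) (auto intro: less_imp_le)
  moreover have "norm x < 1" using less self_conjugate x by blast
  ultimately show False by simp
qed

lemma norm_le_house: "algebraic x \<Longrightarrow> norm x \<le> house x"
  by (intro norm_conjugate_le_house self_conjugate)

section \<open>Lower bounds for linear forms\<close>

text \<open>Iterating \<open>subalg_gens_times\<close>; the product of the \<open>d n\<close> in the
  final exponent originates here.\<close>

lemma subalg_gens_compositum:
  assumes h: "comm_ring_hom h" and fin: "finite I"
    and B: "\<And>i. i \<in> I \<Longrightarrow> subalg_gens h (B i)" "\<And>i. i \<in> I \<Longrightarrow> card (B i) \<le> m i"
  shows "\<exists>C. subalg_gens h C \<and> card C \<le> prod m I \<and> (\<forall>i\<in>I. hom_span h (B i) \<subseteq> hom_span h C)"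
  using fin B
proof (induction I rule: finite_induct)
  case empty
  have "subalg_gens h {1}"
    using hom_span_base[OF h, of "{1}" 1] by (simp add: subalg_gens_def)
  thus ?case by (intro exI[of _ "{1}"]) simp
next
  case (insert i I)
  then obtain C where C: "subalg_gens h C" "card C \<le> prod m I" "\<forall>i\<in>I. hom_span h (B i) \<subseteq> hom_span h C"
    by auto
  have Bi: "subalg_gens h (B i)" "card (B i) \<le> m i" using insert.prems by auto
  note T = subalg_gens_times[OF h Bi(1) C(1)]
  have "card (B i) * card C \<le> prod m (insert i I)"
    using Bi(2) C(2) insert.hyps by (simp add: mult_le_mono)
  hence "card ((\<lambda>(x, y). x * y) ` (B i \<times> C)) \<le> prod m (insert i I)"
    using T(2) by linarith
  moreover have "\<forall>j\<in>insert i I. hom_span h (B j) \<subseteq> hom_span h ((\<lambda>(x, y). x * y) ` (B i \<times> C))"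
    using T(3,4) C(3) by blast
  ultimately show ?case using T(1) by blast
qed

lemma alg_field_hom_span: "subalg_gens (of_rat :: rat \<Rightarrow> complex) B \<Longrightarrow> alg_field (hom_span of_rat B)"
  unfolding alg_field_def
proof (intro conjI ballI subsetI)
  assume B: "subalg_gens (of_rat :: rat \<Rightarrow> complex) B"
  note hom = comm_ring_hom_of_rat_complex
  show "x \<in> hom_span of_rat B" if "x \<in> \<rat>" for x
    using that subalg_gens_hom[OF hom B] by (auto elim: Rats_cases)
  show "x + y \<in> hom_span of_rat B" if "x \<in> hom_span of_rat B" "y \<in> hom_span of_rat B" for x y
    using hom_span_add[OF hom that] .
  show "x * y \<in> hom_span of_rat B" if "x \<in> hom_span of_rat B" "y \<in> hom_span of_rat B" for x y
    using subalg_gens_mult[OF hom B that] .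
  show "algebraic x" if "x \<in> hom_span of_rat B" for x
    using subalg_gens_rat_imp_algebraic[OF B that] .
qed

lemma algebraic_finite_subalg_gens:
  assumes "finite S" "\<And>x. x \<in> S \<Longrightarrow> algebraic x"
  obtains B where "subalg_gens (of_rat :: rat \<Rightarrow> complex) B" "S \<subseteq> hom_span of_rat B"
proof -
  have "\<forall>x\<in>S. \<exists>p. lead_coeff p = 1 \<and> poly (map_poly of_rat p) x = 0"
    using assms(2) by (simp add: algebraic_iff_monic)
  then obtain p where p: "\<And>x. x \<in> S \<Longrightarrow> lead_coeff (p x) = 1 \<and> poly (map_poly of_rat (p x)) x = 0"
    by metis
  define B where "B x = (\<lambda>i. x ^ i) ` {..<degree (p x)}" for x
  have *: "subalg_gens (of_rat :: rat \<Rightarrow> complex) (B x)" "x \<in> hom_span of_rat (B x)" if "x \<in> S" for x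
    using subalg_gens_root[OF comm_ring_hom_of_rat_complex, of "p x" x] p[OF that]
    by (auto simp: B_def)
  show ?thesis
    using subalg_gens_compositum[OF comm_ring_hom_of_rat_complex assms(1), of B "\<lambda>x. card (B x)"]
      * that by blast
qed

section \<open>Generated subfields and their degree\<close>

lemma gen_subfield_closed:
  shows gen_subfield_base: "S \<subseteq> gen_subfield S" and gen_subfield_1: "1 \<in> gen_subfield S"
    and gen_subfield_mult: "x \<in> gen_subfield S \<Longrightarrow> y \<in> gen_subfield S \<Longrightarrow> x * y \<in> gen_subfield S"
  unfolding gen_subfield_def by auto

text \<open>The span is closed under inverses by \<open>alg_field_inverse\<close>, so it is one of
  the fields intersected in \<open>gen_subfield\<close>.\<close>

lemma gen_subfield_subset_hom_span:
  assumes B: "subalg_gens (of_rat :: rat \<Rightarrow> complex) B" and S: "S \<subseteq> hom_span of_rat B"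
  shows "gen_subfield S \<subseteq> hom_span of_rat B"
proof -
  note F = alg_field_hom_span[OF B]
  have "hom_span of_rat B \<in> {F. S \<subseteq> F \<and> 0 \<in> F \<and> 1 \<in> F \<and>
      (\<forall>x\<in>F. \<forall>y\<in>F. x + y \<in> F \<and> x * y \<in> F) \<and> (\<forall>x\<in>F. - x \<in> F) \<and>
      (\<forall>x\<in>F. x \<noteq> 0 \<longrightarrow> inverse x \<in> F)}"
    using S alg_field_rat[OF F] alg_field_add[OF F] alg_field_mult[OF F] alg_field_uminus[OF F]
      alg_field_inverse[OF F] by auto
  thus ?thesis unfolding gen_subfield_def by (rule Inter_lower)
qed

text \<open>A basis of the generated field is a generating set of the right size. It must first be
  shown finite, as an infinite set has \<open>card\<close> 0; this follows because the field lies in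
  the span of finitely many elements.\<close>

lemma field_degree_Q_subalg_gens:
  assumes S: "finite S" "\<And>x. x \<in> S \<Longrightarrow> algebraic x"
  obtains B where "subalg_gens (of_rat :: rat \<Rightarrow> complex) B" "card B = field_degree_Q S"
    "S \<subseteq> hom_span of_rat B"
proof -
  interpret vs: vector_space "\<lambda>(r::rat) (z::complex). of_rat r * z"
    by unfold_locales (auto simp: algebra_simps of_rat_add of_rat_mult)
  have span: "vs.span A = hom_span of_rat A" if "finite A" for A
    using vs.span_finite[OF that] by (auto simp: hom_span_def)
  obtain B0 where B0: "subalg_gens (of_rat :: rat \<Rightarrow> complex) B0" "S \<subseteq> hom_span of_rat B0"
    using algebraic_finite_subalg_gens[OF S] by blast
  have fin0: "finite B0" using B0(1) by (simp add: subalg_gens_def)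
  let ?V = "gen_subfield S"
  have V0: "?V \<subseteq> vs.span B0" using gen_subfield_subset_hom_span[OF B0] span[OF fin0] by simp
  obtain B where B: "B \<subseteq> ?V" "vs.independent B" "?V \<subseteq> vs.span B" "card B = vs.dim ?V"
    using vs.basis_exists[of ?V] by blast
  have fin: "finite B" using vs.independent_span_bound[OF fin0 B(2)] B(1) V0 by blast
  note sp = span[OF fin]
  show ?thesis
  proof (rule that)
    show "card B = field_degree_Q S" using B(4) by (simp add: field_degree_Q_def)
    show "S \<subseteq> hom_span of_rat B" using gen_subfield_base[of S] B(3) sp by simp
    have "x * y \<in> ?V" if "x \<in> B" "y \<in> B" for x y
      using that B(1) by (intro gen_subfield_mult) auto
    thus "subalg_gens (of_rat :: rat \<Rightarrow> complex) B"
      using fin gen_subfield_1[of S] B(3) sp by (auto simp: subalg_gens_def)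
  qed
qed

section \<open>Clearing denominators\<close>

lemma common_denominator:
  assumes "finite (R :: rat set)"
  obtains c :: nat where "c > 0" "\<And>r. r \<in> R \<Longrightarrow> of_nat c * r \<in> \<int>"
proof -
  have "\<exists>c::nat. c > 0 \<and> (\<forall>r\<in>R. of_nat c * r \<in> \<int>)"
    using assms
  proof (induction R rule: finite_induct)
    case (insert r R)
    then obtain c :: nat where c: "c > 0" "\<forall>r\<in>R. of_nat c * r \<in> \<int>" by auto
    obtain a b :: int where ab: "b > 0" "r = of_int a / of_int b"
      by (metis Rat_cases Fract_of_int_quotient)
    have bn: "(of_nat (nat b) :: rat) = of_int b" using ab(1) by simp
    have "of_nat (c * nat b) * r = of_int (int c * a)" using ab by (simp add: bn)
    moreover have "of_nat (c * nat b) * s \<in> \<int>" if "s \<in> R" for s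
    proof -
      have "of_nat (c * nat b) * s = of_int b * (of_nat c * s)" by (simp add: bn)
      moreover have "of_int b * (of_nat c * s) \<in> \<int>" using c(2) that by (intro Ints_mult[OF Ints_of_int]) blast
      ultimately show ?thesis by (simp only:)
    qed
    ultimately show ?case using c(1) ab(1)
      by (intro exI[of _ "c * nat b"]) (auto simp del: of_nat_mult)
  qed (auto intro: exI[of _ 1])
  thus ?thesis using that by blast
qed

text \<open>The number \<open>of_nat c * x\<close> is a root of the monic polynomial with
  coefficients \<open>c ^ (m - i) * coeff p i\<close>, where \<open>m\<close> is the degree of
  \<open>p\<close>. Below the leading one each contains a factor \<open>c\<close>, hence is an
  integer.\<close>

lemma algebraic_int_scale:
  assumes p: "lead_coeff p = (1 :: rat)" "poly (map_poly of_rat p) (x :: complex) = 0"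
    and c: "\<And>i. of_nat c * coeff p i \<in> \<int>"
  shows "algebraic_int (of_nat c * x)"
proof -
  let ?m = "degree p"
  define g where "g i = (if i < ?m then of_nat c ^ (?m - i) * coeff p i else coeff p i)" for i
  have g: "g i \<in> \<int>" for i
  proof (cases "i < ?m")
    case True
    hence "g i = of_nat c ^ (?m - i - 1) * (of_nat c * coeff p i)"
      by (simp add: g_def power_Suc2[symmetric] mult.assoc[symmetric] Suc_diff_Suc del: power_Suc)
    thus ?thesis using c by auto
  next
    case False
    thus ?thesis using p(1) by (cases "i = ?m") (auto simp: g_def coeff_eq_0)
  qed
  define P :: "complex poly" where "P = (\<Sum>i\<le>?m. monom (of_rat (g i)) i)"
  have coeff: "coeff P i = (if i \<le> ?m then of_rat (g i) else 0)" for i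
    by (simp add: P_def coeff_sum)
  have lead: "coeff P ?m = 1" using p(1) by (simp add: coeff g_def)
  have "degree P = ?m"
    using lead by (intro antisym degree_le le_degree) (auto simp: coeff)
  moreover have "coeff P i \<in> \<int>" for i
    using g[of i] by (auto simp: coeff elim!: Ints_cases)
  moreover have "poly P (of_nat c * x) = 0"
  proof -
    have "poly P (of_nat c * x) = (\<Sum>i\<le>?m. of_rat (g i) * (of_nat c * x) ^ i)"
      by (simp add: P_def poly_sum poly_monom)
    also have "\<dots> = (\<Sum>i\<le>?m. of_nat c ^ ?m * (of_rat (coeff p i) * x ^ i))"
      by (intro sum.cong refl)
        (auto simp: g_def of_rat_mult of_rat_power power_mult_distrib mult_ac power_add[symmetric])
    also have "\<dots> = of_nat c ^ ?m * poly (map_poly of_rat p) x"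
      by (simp add: poly_altdef sum_distrib_left coeff_map_poly)
    finally show ?thesis using p(2) by simp
  qed
  ultimately show ?thesis using lead by (intro algebraic_int.intros[of P]) auto
qed

lemma algebraic_clear_denominators:
  assumes "algebraic (x :: complex)" "finite (R :: rat set)"
  obtains c :: nat where "c > 0" "algebraic_int (of_nat c * x)" "\<And>r. r \<in> R \<Longrightarrow> of_nat c * r \<in> \<int>"
proof -
  obtain p where p: "lead_coeff p = (1 :: rat)" "poly (map_poly of_rat p) x = 0"
    using assms(1) by (auto simp: algebraic_iff_monic)
  obtain c :: nat where c: "c > 0" "\<And>r. r \<in> R \<union> coeff p ` {..degree p} \<Longrightarrow> of_nat c * r \<in> \<int>"
    using common_denominator[of "R \<union> coeff p ` {..degree p}"] assms(2) by auto
  have "of_nat c * coeff p i \<in> \<int>" for i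
    using c(2)[of "coeff p i"] by (cases "i \<le> degree p") (auto simp: coeff_eq_0)
  from algebraic_int_scale[OF p this] c that show ?thesis by blast
qed

text \<open>A Liouville type estimate: \<open>y\<close> times \<open>c\<close> and all
  \<open>\<alpha> j\<close> is a nonzero algebraic integer of degree at most \<open>m\<close>, and
  all its conjugates are bounded by the houses, so \<open>norm_conjugates_bound\<close>
  applies.\<close>

lemma linear_form_lower_bound:
  fixes \<gamma> :: complex and \<alpha> :: "'j \<Rightarrow> complex" and b :: "'j \<Rightarrow> nat" and r :: "'j \<Rightarrow> rat" and c :: nat
    and R :: real
  assumes fin: "finite J" and \<alpha>: "\<And>j. j \<in> J \<Longrightarrow> algebraic_int (\<alpha> j)" "\<And>j. j \<in> J \<Longrightarrow> \<alpha> j \<noteq> 0"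
    and b: "\<And>j. j \<in> J \<Longrightarrow> b j \<ge> 1"
    and c: "c > 0" "algebraic_int (of_nat c * \<gamma>)" "\<And>j. j \<in> J \<Longrightarrow> of_nat c * r j \<in> \<int>"
    and R: "\<And>j. j \<in> J \<Longrightarrow> norm (of_rat (r j) :: complex) \<le> R" "R \<ge> 0"
    and B: "subalg_gens (of_rat :: rat \<Rightarrow> complex) B" "card B \<le> m" "\<gamma> \<in> hom_span of_rat B"
      "\<And>j. j \<in> J \<Longrightarrow> \<alpha> j \<in> hom_span of_rat B"
  defines "y \<equiv> \<gamma> - (\<Sum>j\<in>J. of_rat (r j) * (of_nat (b j) / \<alpha> j))"
  assumes y: "y \<noteq> 0"
  shows "1 \<le> norm y * (c * (house \<gamma> + card J * R + 1) * (\<Prod>j\<in>J. b j * house (\<alpha> j))) ^ m"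
proof -
  define F where "F = hom_span (of_rat :: rat \<Rightarrow> complex) B"
  have F: "alg_field F" unfolding F_def by (rule alg_field_hom_span[OF B(1)])
  have \<gamma>F: "\<gamma> \<in> F" and \<alpha>F: "\<And>j. j \<in> J \<Longrightarrow> \<alpha> j \<in> F" using B by (auto simp: F_def)
  \<comment> \<open>The product of all \<open>\<alpha> j\<close> clears the denominators of the sum,
    and \<open>c\<close> those of \<open>\<gamma>\<close> and of the \<open>r j\<close>.\<close>
  define x where "x = of_nat c * (\<Prod>j\<in>J. \<alpha> j) * y"
  have others: "(\<Prod>j\<in>J. \<alpha> j) / \<alpha> j = (\<Prod>i\<in>J-{j}. \<alpha> i)" if "j \<in> J" for j
    using prod.remove[OF fin that, of \<alpha>] \<alpha>(2)[OF that] by simp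
  have x_eq: "x = (of_nat c * \<gamma>) * (\<Prod>j\<in>J. \<alpha> j)
      - (\<Sum>j\<in>J. of_rat (of_nat c * r j) * of_nat (b j) * (\<Prod>i\<in>J-{j}. \<alpha> i))"
  proof -
    have "(\<Sum>j\<in>J. of_rat (of_nat c * r j) * of_nat (b j) * (\<Prod>i\<in>J-{j}. \<alpha> i))
        = (\<Sum>j\<in>J. of_nat c * (\<Prod>j\<in>J. \<alpha> j) * (of_rat (r j) * (of_nat (b j) / \<alpha> j)))"
      by (intro sum.cong refl) (simp add: others[symmetric] of_rat_mult)
    thus ?thesis by (simp add: x_def y_def right_diff_distrib sum_distrib_left mult_ac)
  qed
  have "of_rat (of_nat c * r j) \<in> (\<int> :: complex set)" if "j \<in> J" for j
    using c(3)[OF that] by (elim Ints_cases) simp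
  hence "algebraic_int (\<Sum>j\<in>J. of_rat (of_nat c * r j) * of_nat (b j) * (\<Prod>i\<in>J-{j}. \<alpha> i))"
    using \<alpha>(1) by (intro algebraic_int_sum algebraic_int_mult algebraic_int_prod)
      (auto intro: int_imp_algebraic_int)
  moreover have "algebraic_int ((of_nat c * \<gamma>) * (\<Prod>j\<in>J. \<alpha> j))"
    using \<alpha>(1) by (intro algebraic_int_mult[OF c(2)] algebraic_int_prod)
  ultimately have int: "algebraic_int x" unfolding x_eq diff_conv_add_uminus
    by (intro algebraic_int_add algebraic_int_minus)
  have x0: "x \<noteq> 0" using c(1) \<alpha>(2) y fin by (simp add: x_def)
  have xF: "x \<in> F" unfolding x_eq
    by (intro alg_field_diff[OF F] alg_field_mult[OF F] alg_field_prod[OF F] alg_field_sum[OF F] \<gamma>F \<alpha>F)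
      (auto intro!: alg_field_rat[OF F])
  have ax: "algebraic x" using int by auto
  obtain p where p: "lead_coeff p = (1 :: rat)" "degree p = card B" "poly (map_poly of_rat p) x = 0"
    using subalg_gens_integral[OF comm_ring_hom_of_rat_complex B(1)] xF unfolding F_def by blast
  have deg: "degree (min_poly_rat x) \<le> m"
    using min_poly_rat(4)[OF ax, of p] p B(2) by fastforce
  have "degree (min_poly_rat x) \<noteq> 0"
  proof
    assume "degree (min_poly_rat x) = 0"
    then obtain a where "min_poly_rat x = [:a:]" by (metis degree_eq_zeroE)
    thus False using min_poly_rat(1,3)[OF ax] by auto
  qed
  \<comment> \<open>The element \<open>x\<close> itself is one of the conjugates, so only
    \<open>m - 1\<close> of them need the bound \<open>H\<close>.\<close>
  then obtain m' where m': "m = Suc m'" using deg by (cases m) auto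
  define h where "h j = house (\<alpha> j)" for j
  have h1: "h j \<ge> 1" if "j \<in> J" for j unfolding h_def using \<alpha>[OF that] by (intro house_ge_1) auto
  define P where "P = (\<Prod>j\<in>J. b j * h j)"
  have bh: "1 \<le> b j * h j" "h j \<le> b j * h j" if "j \<in> J" for j
  proof -
    have "1 * h j \<le> b j * h j" using h1[OF that] b[OF that] by (intro mult_right_mono) auto
    thus "h j \<le> b j * h j" by simp
    thus "1 \<le> b j * h j" using h1[OF that] by linarith
  qed
  have h0: "h j \<ge> 0" if "j \<in> J" for j using h1[OF that] by linarith
  have P1: "P \<ge> 1" unfolding P_def using bh by (intro prod_ge_1) auto
  have hP: "(\<Prod>j\<in>J. h j) \<le> P" unfolding P_def using bh h0 by (intro prod_mono) auto
  have bP: "b j * (\<Prod>i\<in>J-{j}. h i) \<le> P" if "j \<in> J" for j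
  proof -
    have "b j * (\<Prod>i\<in>J-{j}. h i) \<le> (b j * h j) * (\<Prod>i\<in>J-{j}. b i * h i)"
      using bh h0 h1[OF that] that by (intro mult_mono prod_mono prod_nonneg) (auto simp: mult_le_cancel_left1)
    also have "\<dots> = P" unfolding P_def by (rule prod.remove[OF fin that, symmetric])
    finally show ?thesis .
  qed
  \<comment> \<open>The summands \<open>house \<gamma>\<close> and \<open>card J * R\<close> bound
    the conjugates of \<open>x\<close>; the extra 1 ensures \<open>c * P \<le> H\<close>, which
    later allows \<open>norm x\<close> to be replaced by \<open>H * norm y\<close>.\<close>
  define H where "H = c * (house \<gamma> + card J * R + 1) * P"
  have house\<gamma>: "house \<gamma> \<ge> 0"
    using norm_le_house[OF alg_field_algebraic[OF F \<gamma>F]] norm_ge_zero[of \<gamma>] by linarith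
  have E1: "1 \<le> house \<gamma> + card J * R + 1" using house\<gamma> R(2) by simp
  have cP: "c * P \<le> H"
  proof -
    have "c * P * 1 \<le> c * P * (house \<gamma> + card J * R + 1)"
      using E1 P1 by (intro mult_left_mono) auto
    thus ?thesis by (simp add: H_def mult_ac)
  qed
  have "1 * 1 \<le> c * P" using c(1) P1 by (intro mult_mono) auto
  hence H1: "H \<ge> 1" using cP by linarith
  have conj: "norm z \<le> H" if z: "z \<in> conjugates x" for z
  proof -
    obtain F' \<sigma> where F': "alg_field F'" "emb F' \<sigma>" "x \<in> F'" "insert \<gamma> (\<alpha> ` J) \<subseteq> F'" "\<sigma> x = z"
      using emb_conjugate[OF ax z, of "insert \<gamma> (\<alpha> ` J)"] fin \<gamma>F \<alpha>F alg_field_algebraic[OF F] by blast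
    have \<alpha>F': "\<alpha> j \<in> F'" if "j \<in> J" for j using F'(4) that by auto
    have \<gamma>F': "\<gamma> \<in> F'" using F'(4) by auto
    have s\<alpha>: "norm (\<sigma> (\<alpha> j)) \<le> h j" if "j \<in> J" for j
      unfolding h_def by (rule norm_emb_le_house[OF F'(1,2) \<alpha>F'[OF that]])
    have sprod: "norm (\<sigma> (prod \<alpha> I)) \<le> (\<Prod>j\<in>I. h j)" if "I \<subseteq> J" for I
      using that \<alpha>F' s\<alpha> by (subst emb_prod[OF F'(1,2)]) (auto simp: prod_norm[symmetric] intro!: prod_mono)
    define u where "u j = of_rat (of_nat c * r j) * of_nat (b j) * (\<Prod>i\<in>J-{j}. \<alpha> i)" for j
    have rat: "of_nat c \<in> F'" "of_rat s \<in> F'" "of_nat c \<in> F'" for s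
      using alg_field_rat[OF F'(1)] by auto
    have ratb: "of_rat (of_nat c * r j) * of_nat (b j) \<in> (\<rat> :: complex set)" for j by auto
    have prodF: "prod \<alpha> I \<in> F'" if "I \<subseteq> J" for I
      using that \<alpha>F' by (intro alg_field_prod[OF F'(1)]) auto
    have uF: "u j \<in> F'" for j unfolding u_def
      using ratb by (intro alg_field_mult[OF F'(1)] prodF alg_field_rat[OF F'(1)]) auto
    have su: "norm (\<sigma> (u j)) \<le> c * R * P" if "j \<in> J" for j
    proof -
      have "\<sigma> (u j) = of_rat (of_nat c * r j) * of_nat (b j) * \<sigma> (\<Prod>i\<in>J-{j}. \<alpha> i)"
        unfolding u_def using ratb
        by (subst emb_mult[OF F'(1,2)]) (auto intro!: alg_field_rat[OF F'(1)] prodF simp: emb_rat[OF F'(1,2)])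
      also have "norm \<dots> = c * norm (of_rat (r j) :: complex) * (b j * norm (\<sigma> (\<Prod>i\<in>J-{j}. \<alpha> i)))"
        by (simp add: norm_mult of_rat_mult)
      also have "\<dots> \<le> c * R * (b j * (\<Prod>i\<in>J-{j}. h i))"
        using R that by (intro mult_mono mult_left_mono sprod) auto
      also have "\<dots> \<le> c * R * P" using bP[OF that] R(2) by (intro mult_left_mono) auto
      finally show ?thesis .
    qed
    have "z = \<sigma> (of_nat c * \<gamma> * (\<Prod>j\<in>J. \<alpha> j) - (\<Sum>j\<in>J. u j))"
      unfolding u_def using F'(5) x_eq by simp
    also have "\<dots> = \<sigma> (of_nat c * \<gamma> * (\<Prod>j\<in>J. \<alpha> j)) - (\<Sum>j\<in>J. \<sigma> (u j))"
      using rat \<gamma>F' prodF uF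
      by (simp add: emb_diff[OF F'(1,2)] emb_sum[OF F'(1,2)] alg_field_mult[OF F'(1)] alg_field_sum[OF F'(1)])
    also have "\<sigma> (of_nat c * \<gamma> * (\<Prod>j\<in>J. \<alpha> j)) = of_nat c * \<sigma> \<gamma> * \<sigma> (\<Prod>j\<in>J. \<alpha> j)"
      using rat \<gamma>F' prodF by (simp add: emb_mult[OF F'(1,2)] emb_rat[OF F'(1,2)] alg_field_mult[OF F'(1)])
    finally have "norm z \<le> norm (of_nat c * \<sigma> \<gamma> * \<sigma> (\<Prod>j\<in>J. \<alpha> j)) + norm (\<Sum>j\<in>J. \<sigma> (u j))"
      by (metis norm_triangle_ineq4)
    also have "norm (of_nat c * \<sigma> \<gamma> * \<sigma> (\<Prod>j\<in>J. \<alpha> j)) \<le> c * house \<gamma> * P"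
    proof -
      have "norm (\<sigma> (\<Prod>j\<in>J. \<alpha> j)) \<le> P" using sprod[of J] hP by simp
      thus ?thesis using norm_emb_le_house[OF F'(1,2) \<gamma>F'] P1 house\<gamma>
        by (auto simp: norm_mult intro!: mult_mono)
    qed
    also have "norm (\<Sum>j\<in>J. \<sigma> (u j)) \<le> (\<Sum>j\<in>J. c * R * P)"
      by (rule sum_norm_le) (rule su)
    finally have "norm z \<le> c * (house \<gamma> + card J * R) * P" by (simp add: algebra_simps)
    also have "\<dots> \<le> H" unfolding H_def using P1 by (intro mult_right_mono mult_left_mono) auto
    finally show ?thesis .
  qed
  have "1 \<le> norm x * H ^ m'"
    by (rule norm_conjugates_bound[OF int x0 H1 conj deg[unfolded m']])
  \<comment> \<open>Passing from \<open>x\<close> back to \<open>y\<close> costs one more factor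
    \<open>H\<close>, which raises the exponent from \<open>m'\<close> to \<open>m\<close>.\<close>
  also have "norm x \<le> H * norm y"
  proof -
    have "norm (\<Prod>j\<in>J. \<alpha> j) \<le> (\<Prod>j\<in>J. h j)"
      unfolding prod_norm[symmetric] h_def
      using norm_le_house alg_field_algebraic[OF F] \<alpha>F by (intro prod_mono) auto
    hence "c * norm (\<Prod>j\<in>J. \<alpha> j) \<le> H" using hP cP
      by (meson mult_left_mono of_nat_0_le_iff order_trans)
    thus ?thesis unfolding x_def norm_mult by (intro mult_right_mono) auto
  qed
  hence "norm x * H ^ m' \<le> H * norm y * H ^ m'" using H1 by (intro mult_right_mono) auto
  finally show ?thesis by (simp add: m' H_def P_def h_def mult_ac)
qed

lemma alg_degree_le_imp_subalg_gens:
  assumes "alg_degree x \<le> enat D"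
  obtains B where "algebraic x" "subalg_gens (of_rat :: rat \<Rightarrow> complex) B" "card B \<le> D" "x \<in> hom_span of_rat B"
proof -
  \<comment> \<open>A strict inequality for the infimum yields a witness; in particular
    \<open>x\<close> is algebraic, since the infimum of the empty set is infinite.\<close>
  have "alg_degree x < enat (Suc D)" using assms by (rule order.strict_trans1) simp
  then obtain p :: "rat poly" where p: "p \<noteq> 0" "poly (map_poly of_rat p) x = 0" "degree p \<le> D"
    unfolding alg_degree_def INF_less_iff by auto
  define r where "r = Polynomial.smult (inverse (lead_coeff p)) p"
  have r: "lead_coeff r = 1" "poly (map_poly of_rat r) x = 0" "degree r \<le> D"
    using p by (auto simp: r_def of_rat_hom.map_poly_hom_smult)
  note B = subalg_gens_root[OF comm_ring_hom_of_rat_complex r(1,2)]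
  show ?thesis
    by (rule that[OF _ B(1) _ B(3)]) (use r B(2) in \<open>auto simp: algebraic_iff_monic\<close>)
qed

text \<open>The estimate \<open>linear_form_lower_bound\<close> for the index pairs up to
  \<open>N\<close>. The denominators of \<open>\<gamma>\<close> and of the \<open>q i\<close> are
  cleared once for all \<open>N\<close>, and the number of terms grows linearly in \<open>N\<close>,
  so \<open>C\<close> does not depend on \<open>N\<close>.\<close>

lemma partial_sum_lower_bound:
  fixes D K :: nat and d :: "nat \<Rightarrow> nat" and b :: "nat \<Rightarrow> nat \<Rightarrow> nat" and \<alpha> :: "nat \<Rightarrow> nat \<Rightarrow> complex"
    and q :: "nat \<Rightarrow> rat"
  assumes \<gamma>: "alg_degree \<gamma> \<le> enat D"
    and b: "\<And>i n. 1 \<le> i \<Longrightarrow> i \<le> K \<Longrightarrow> n \<ge> 1 \<Longrightarrow> b i n \<ge> 1"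
    and \<alpha>: "\<And>i n. 1 \<le> i \<Longrightarrow> i \<le> K \<Longrightarrow> n \<ge> 1 \<Longrightarrow> algebraic_int (\<alpha> i n)"
      "\<And>i n. 1 \<le> i \<Longrightarrow> i \<le> K \<Longrightarrow> n \<ge> 1 \<Longrightarrow> \<alpha> i n \<noteq> 0"
    and d: "\<And>n. n \<ge> 1 \<Longrightarrow> field_degree_Q ((\<lambda>i. \<alpha> i n) ` {1..K}) \<le> d n"
  defines "y \<equiv> (\<lambda>N. \<gamma> - (\<Sum>n=1..N. \<Sum>i=1..K. of_rat (q i) * (of_nat (b i n) / \<alpha> i n)))"
  shows "\<exists>C\<ge>1. \<forall>N. y N \<noteq> 0 \<longrightarrow>
    1 \<le> norm (y N) * (C * (real N + 1) * (\<Prod>n=1..N. \<Prod>i=1..K. b i n * house (\<alpha> i n))) ^ (D * (\<Prod>n=1..N. d n))"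
proof -
  obtain B\<^sub>\<gamma> where B\<^sub>\<gamma>: "algebraic \<gamma>" "subalg_gens (of_rat :: rat \<Rightarrow> complex) B\<^sub>\<gamma>" "card B\<^sub>\<gamma> \<le> D"
    "\<gamma> \<in> hom_span of_rat B\<^sub>\<gamma>"
    using alg_degree_le_imp_subalg_gens[OF \<gamma>] by blast
  obtain c :: nat where c: "c > 0" "algebraic_int (of_nat c * \<gamma>)" "\<And>r. r \<in> q ` {1..K} \<Longrightarrow> of_nat c * r \<in> \<int>"
    using algebraic_clear_denominators[OF B\<^sub>\<gamma>(1), of "q ` {1..K}"] by blast
  define R where "R = (\<Sum>i=1..K. norm (of_rat (q i) :: complex))"
  have R: "norm (of_rat (q i) :: complex) \<le> R" if "i \<in> {1..K}" for i
    unfolding R_def using that by (intro member_le_sum) auto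
  have R0: "R \<ge> 0" unfolding R_def by (intro sum_nonneg) auto
  have h0: "house \<gamma> \<ge> 0" using norm_le_house[OF B\<^sub>\<gamma>(1)] norm_ge_zero[of \<gamma>] by linarith
  define C where "C = c * (house \<gamma> + K * R + 1)"
  have "1 * 1 \<le> C" unfolding C_def using c(1) h0 R0 by (intro mult_mono) auto
  hence C1: "C \<ge> 1" by simp
  have "\<forall>n\<in>{1..}. \<exists>B. subalg_gens (of_rat :: rat \<Rightarrow> complex) B \<and> card B \<le> d n \<and> (\<lambda>i. \<alpha> i n) ` {1..K} \<subseteq> hom_span of_rat B"
  proof
    fix n :: nat assume "n \<in> {1..}"
    hence n: "n \<ge> 1" by simp
    have "algebraic x" if "x \<in> (\<lambda>i. \<alpha> i n) ` {1..K}" for x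
      using that \<alpha>(1)[OF _ _ n] by (auto intro!: algebraic_int_imp_algebraic)
    from field_degree_Q_subalg_gens[OF _ this] d[OF n]
    show "\<exists>B. subalg_gens (of_rat :: rat \<Rightarrow> complex) B \<and> card B \<le> d n \<and> (\<lambda>i. \<alpha> i n) ` {1..K} \<subseteq> hom_span of_rat B"
      by (metis finite_atLeastAtMost finite_imageI)
  qed
  then obtain Bn where Bn: "\<And>n. n \<ge> 1 \<Longrightarrow> subalg_gens (of_rat :: rat \<Rightarrow> complex) (Bn n) \<and> card (Bn n) \<le> d n \<and>
      (\<lambda>i. \<alpha> i n) ` {1..K} \<subseteq> hom_span of_rat (Bn n)"
    by (metis atLeast_iff)
  show ?thesis
  proof (intro exI[of _ C] conjI C1 allI impI)
    fix N assume y0: "y N \<noteq> 0"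
    define B where "B n = (if n = 0 then B\<^sub>\<gamma> else Bn n)" for n
    define m where "m n = (if n = 0 then D else d n)" for n
    have "\<exists>C. subalg_gens (of_rat :: rat \<Rightarrow> complex) C \<and> card C \<le> prod m {0..N} \<and>
        (\<forall>i\<in>{0..N}. hom_span of_rat (B i) \<subseteq> hom_span of_rat C)"
      using B\<^sub>\<gamma>(2,3) Bn by (intro subalg_gens_compositum comm_ring_hom_of_rat_complex) (auto simp: B_def m_def)
    then obtain A where A: "subalg_gens (of_rat :: rat \<Rightarrow> complex) A" "card A \<le> prod m {0..N}"
      "\<And>i. i \<le> N \<Longrightarrow> hom_span of_rat (B i) \<subseteq> hom_span of_rat A" by auto
    have "prod m {0..N} = D * (\<Prod>n=1..N. d n)"
      by (subst prod.atLeast_Suc_atMost) (auto simp: m_def intro!: prod.cong)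
    note A(2)[unfolded this]
    define J where "J = {1..N} \<times> {1..K}"
    have sum: "(\<Sum>n=1..N. \<Sum>i=1..K. of_rat (q i) * (of_nat (b i n) / \<alpha> i n))
      = (\<Sum>(n,i)\<in>J. of_rat (q i) * (of_nat (b i n) / \<alpha> i n))"
      unfolding J_def by (rule sum.cartesian_product)
    have prod: "(\<Prod>n=1..N. \<Prod>i=1..K. b i n * house (\<alpha> i n)) = (\<Prod>(n,i)\<in>J. b i n * house (\<alpha> i n))"
      unfolding J_def by (rule prod.cartesian_product)
    have y: "y N = \<gamma> - (\<Sum>j\<in>J. of_rat (q (snd j)) * (of_nat (b (snd j) (fst j)) / \<alpha> (snd j) (fst j)))"
      unfolding y_def sum by (simp add: case_prod_unfold)
    have \<alpha>A: "\<alpha> (snd j) (fst j) \<in> hom_span of_rat A" if "j \<in> J" for j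
    proof -
      have j: "1 \<le> fst j" "fst j \<le> N" "snd j \<in> {1..K}" using that by (auto simp: J_def)
      have "\<alpha> (snd j) (fst j) \<in> (\<lambda>i. \<alpha> i (fst j)) ` {1..K}" using j(3) by (rule imageI)
      also have "\<dots> \<subseteq> hom_span of_rat (B (fst j))" using Bn[OF j(1)] j(1) by (simp add: B_def)
      also have "\<dots> \<subseteq> hom_span of_rat A" using A(3)[OF j(2)] .
      finally show ?thesis .
    qed
    have \<gamma>A: "\<gamma> \<in> hom_span of_rat A" using A(3)[of 0] B\<^sub>\<gamma>(4) by (auto simp: B_def)
    have P0: "(\<Prod>j\<in>J. b (snd j) (fst j) * house (\<alpha> (snd j) (fst j))) \<ge> 0"
    proof (intro prod_nonneg ballI mult_nonneg_nonneg)
      fix j assume "j \<in> J"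
      hence "house (\<alpha> (snd j) (fst j)) \<ge> 1" by (intro house_ge_1 \<alpha>) (auto simp: J_def)
      thus "0 \<le> house (\<alpha> (snd j) (fst j))" by simp
    qed simp
    have "1 \<le> norm (y N) * (c * (house \<gamma> + card J * R + 1) *
        (\<Prod>j\<in>J. b (snd j) (fst j) * house (\<alpha> (snd j) (fst j)))) ^ (D * (\<Prod>n=1..N. d n))"
      unfolding y
    proof (rule linear_form_lower_bound[where B = A])
      show "card A \<le> D * (\<Prod>n=1..N. d n)" by fact
      show "\<gamma> - (\<Sum>j\<in>J. of_rat (q (snd j)) * (of_nat (b (snd j) (fst j)) / \<alpha> (snd j) (fst j))) \<noteq> 0"
        using y0 y by simp
    qed (use c R R0 \<alpha> b A(1) \<alpha>A \<gamma>A in \<open>auto simp: J_def\<close>)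
    also have "\<dots> \<le> norm (y N) * (C * (real N + 1) *
        (\<Prod>j\<in>J. b (snd j) (fst j) * house (\<alpha> (snd j) (fst j)))) ^ (D * (\<Prod>n=1..N. d n))"
    proof (intro mult_left_mono power_mono mult_right_mono P0 mult_nonneg_nonneg norm_ge_zero)
      have "real (card J) = real N * real K" by (simp add: J_def card_cartesian_product)
      hence "house \<gamma> + card J * R + 1 \<le> (house \<gamma> + K * R + 1) * (real N + 1)"
        using h0 R0 by (simp add: algebra_simps)
      thus "c * (house \<gamma> + card J * R + 1) \<le> C * (real N + 1)"
        unfolding C_def mult.assoc by (intro mult_left_mono) auto
    qed (use h0 R0 in auto)
    finally show "1 \<le> norm (y N) * (C * (real N + 1) *
        (\<Prod>n=1..N. \<Prod>i=1..K. b i n * house (\<alpha> i n))) ^ (D * (\<Prod>n=1..N. d n))"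
      unfolding prod by (simp add: case_prod_unfold)
  qed
qed

section \<open>Growth of the heights\<close>

text \<open>If \<open>\<rho>\<close> comes arbitrarily close to 0, near steps raise it by summable
  errors only and far steps do so no more once \<open>g < 1\<close>, so \<open>l\<close> is
  eventually at most \<open>\<beta>\<close>. If \<open>\<rho>\<close> stays above a positive bound,
  far steps are impossible in the long run, since \<open>g\<close> tends to 0; then
  \<open>\<rho>\<close> converges and the values of \<open>l\<close> below \<open>\<alpha>\<close>
  would pull it down.\<close>

lemma near_far_contradiction:
  fixes \<rho> l \<omega> g w :: "nat \<Rightarrow> real" and R C \<alpha> \<beta> :: real
  assumes \<rho>: "\<And>n. \<rho> n \<ge> 0" "\<And>n. \<rho> n \<le> R"
    and \<omega>: "\<And>n. \<omega> n \<ge> 0" "summable \<omega>"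
    and g: "g \<longlonglongrightarrow> 0" and C: "C \<ge> 1"
    and w: "\<And>n. 1/2 \<le> w n" "\<And>n. w n \<le> 1"
    and step: "\<And>n. \<rho> (Suc n) \<le> (1 - w n) * \<rho> n + w n * l (Suc n)"
    and near_far: "\<And>N. N \<ge> N0 \<Longrightarrow> l (Suc N) \<le> \<rho> N + \<omega> N \<or>
      (\<exists>n>N. \<rho> n \<le> g N * (\<rho> N + \<omega> N) \<and> (\<forall>m\<in>{N<..n}. l m \<le> C * (\<rho> N + \<omega> N)))"
    and \<alpha>\<beta>: "\<alpha> < \<beta>" "0 < \<beta>"
    and l: "\<exists>\<^sub>F n in sequentially. l n < \<alpha>" "\<exists>\<^sub>F n in sequentially. l n > \<beta>"
  shows False
proof -
  have near_step: "\<rho> (Suc N) \<le> \<rho> N + \<omega> N" if "l (Suc N) \<le> \<rho> N + \<omega> N" for N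
  proof -
    have "w N * l (Suc N) \<le> w N * (\<rho> N + \<omega> N)" using that w(1)[of N] by (intro mult_left_mono) auto
    moreover have "w N * \<omega> N \<le> 1 * \<omega> N" using w(2)[of N] \<omega>(1)[of N] by (intro mult_right_mono) auto
    ultimately show ?thesis using step[of N] by (simp add: algebra_simps)
  qed
  show False
  proof (cases "\<forall>\<eta>>0. \<exists>\<^sub>F n in sequentially. \<rho> n \<le> \<eta>")
    case True
    \<comment> \<open>Once \<open>\<rho>\<close> is small, it stays small along a sequence of indices in which every
      near or far step leads to the next, and the far steps control \<open>l\<close> in between.\<close>
    define \<eta> where "\<eta> = \<beta> / (3 * C)"
    have \<eta>: "\<eta> > 0" "C * (2 * \<eta>) \<le> \<beta>" using \<alpha>\<beta> C by (auto simp: \<eta>_def)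
    obtain N1 where N1: "\<And>m n. m \<ge> N1 \<Longrightarrow> norm (sum \<omega> {m..<n}) < \<eta>"
      using \<omega>(2) \<eta>(1) unfolding summable_Cauchy by blast
    obtain N2 where N2: "\<And>n. n \<ge> N2 \<Longrightarrow> g n < 1"
      using order_tendstoD(2)[OF g, of 1] by (auto simp: eventually_sequentially)
    obtain j0 where j0: "j0 \<ge> max N0 (max N1 N2)" "\<rho> j0 \<le> \<eta>"
      using True[rule_format, OF \<eta>(1)] unfolding frequently_sequentially by blast
    define s where "s j = sum \<omega> {j0..<j}" for j
    have s: "s j \<le> \<eta>" for j using N1[of j0 j] j0 by (simp add: s_def abs_less_iff)
    have s_Suc: "s (Suc j) = s j + \<omega> j" if "j \<ge> j0" for j using that by (simp add: s_def)
    have s_mono: "s i \<le> s j" if "i \<le> j" for i j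
      unfolding s_def using that \<omega>(1) by (intro sum_mono2) auto
    \<comment> \<open>Only some \<open>j \<ge> m\<close> can be claimed, because a far step jumps
      over indices; the bound for \<open>l\<close> on the whole interval covers the indices jumped
      over.\<close>
    have "\<exists>j\<ge>m. \<rho> j \<le> \<eta> + s j \<and> (\<forall>k\<in>{j0<..j}. l k \<le> C * (2 * \<eta>))" if "m \<ge> j0" for m
      using that
    proof (induction m rule: dec_induct)
      case base
      show ?case using j0 by (intro exI[of _ j0]) (auto simp: s_def)
    next
      case (step m)
      then obtain j where j: "j \<ge> m" "\<rho> j \<le> \<eta> + s j" "\<forall>k\<in>{j0<..j}. l k \<le> C * (2 * \<eta>)" by blast
      show ?case
      proof (cases "j \<ge> Suc m")
        case True
        thus ?thesis using j by blast
      next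
        case False
        have jj: "j \<ge> j0" "j = m" using False j step by auto
        have sum: "\<rho> j + \<omega> j \<le> \<eta> + s (Suc j)" using j(2) s_Suc[OF jj(1)] by simp
        hence sum2: "\<rho> j + \<omega> j \<le> 2 * \<eta>" using s[of "Suc j"] by simp
        have nn: "\<rho> j + \<omega> j \<ge> 0" using \<rho>(1) \<omega>(1) by (simp add: add_nonneg_nonneg)
        have Csum: "C * (\<rho> j + \<omega> j) \<le> C * (2 * \<eta>)" using sum2 C by (intro mult_left_mono) auto
        have N0: "j \<ge> N0" using jj j0 by simp
        from near_far[OF N0] show ?thesis
        proof
          assume near: "l (Suc j) \<le> \<rho> j + \<omega> j"
          also have "\<dots> \<le> C * (\<rho> j + \<omega> j)" using mult_right_mono[OF C nn] by simp
          finally have "l (Suc j) \<le> C * (2 * \<eta>)" using Csum by simp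
          hence "\<forall>k\<in>{j0<..Suc j}. l k \<le> C * (2 * \<eta>)" using j(3) by (auto simp: le_Suc_eq)
          thus ?thesis using near_step[OF near] sum jj by (intro exI[of _ "Suc j"]) auto
        next
          assume "\<exists>n>j. \<rho> n \<le> g j * (\<rho> j + \<omega> j) \<and> (\<forall>m\<in>{j<..n}. l m \<le> C * (\<rho> j + \<omega> j))"
          then obtain n where n: "n > j" "\<rho> n \<le> g j * (\<rho> j + \<omega> j)"
            "\<And>m. m \<in> {j<..n} \<Longrightarrow> l m \<le> C * (\<rho> j + \<omega> j)" by blast
          have "g j * (\<rho> j + \<omega> j) \<le> 1 * (\<rho> j + \<omega> j)"
            using N2[of j] jj j0 nn by (intro mult_right_mono) auto
          hence "\<rho> n \<le> \<eta> + s n" using n(2) sum s_mono[of "Suc j" n] n(1) by simp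
          moreover have "l k \<le> C * (2 * \<eta>)" if "k \<in> {j0<..n}" for k
            using that n(3)[of k] Csum j(3) by (cases "k \<le> j") auto
          ultimately show ?thesis using n(1) jj by (intro exI[of _ n]) auto
        qed
      qed
    qed
    hence "l k \<le> \<beta>" if "k \<ge> Suc j0" for k
      using that \<eta>(2) by (metis Suc_le_eq greaterThanAtMost_iff less_imp_le order_trans)
    hence "\<forall>\<^sub>F n in sequentially. \<not> l n > \<beta>"
      unfolding eventually_sequentially by (meson not_less)
    thus False using l(2) by (simp add: frequently_def)
  next
    case False
    then obtain \<eta> where \<eta>: "\<eta> > 0" "\<forall>\<^sub>F n in sequentially. \<rho> n > \<eta>"
      by (auto simp: not_frequently not_le)
    then obtain N1 where N1: "\<And>n. n \<ge> N1 \<Longrightarrow> \<rho> n > \<eta>" by (auto simp: eventually_sequentially)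
    have \<omega>0: "\<omega> \<longlonglongrightarrow> 0" using \<omega>(2) by (rule summable_LIMSEQ_zero)
    have "(\<lambda>n. \<bar>g n\<bar> * (R + \<omega> n)) \<longlonglongrightarrow> \<bar>0\<bar> * (R + 0)"
      by (intro tendsto_intros g \<omega>0)
    hence "\<forall>\<^sub>F n in sequentially. \<bar>g n\<bar> * (R + \<omega> n) < \<eta>"
      using \<eta>(1) by (intro order_tendstoD(2)[where y = "\<bar>0\<bar> * (R + 0)"]) auto
    then obtain N2 where N2: "\<And>n. n \<ge> N2 \<Longrightarrow> \<bar>g n\<bar> * (R + \<omega> n) < \<eta>" by (auto simp: eventually_sequentially)
    define N3 where "N3 = max N0 (max N1 N2)"
    \<comment> \<open>A far step would make some later \<open>\<rho> n\<close> smaller than its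
      lower bound \<open>\<eta>\<close>.\<close>
    have near: "l (Suc N) \<le> \<rho> N + \<omega> N" if N: "N \<ge> N3" for N
    proof (rule ccontr)
      assume "\<not> ?thesis"
      with near_far[of N] N obtain n where n: "n > N" "\<rho> n \<le> g N * (\<rho> N + \<omega> N)"
        by (auto simp: N3_def)
      have "g N * (\<rho> N + \<omega> N) \<le> \<bar>g N\<bar> * (R + \<omega> N)"
        using \<rho> \<omega>(1) by (intro mult_mono) (auto simp: add_nonneg_nonneg)
      thus False using n N N1[of n] N2[of N] by (simp add: N3_def)
    qed
    \<comment> \<open>\<open>\<rho>\<close> converges, since it decreases up to a summable error.\<close>
    define u where "u n = \<rho> (n + N3) - (\<Sum>k<n + N3. \<omega> k)" for n
    have "decseq u"
      unfolding decseq_Suc_iff u_def using near_step[OF near] by (simp add: algebra_simps)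
    moreover have "-suminf \<omega> \<le> u n" for n
      using \<rho>(1)[of "n + N3"] sum_le_suminf[OF \<omega>(2), of "{..<n + N3}"] \<omega>(1) by (simp add: u_def)
    ultimately obtain u0 where u0: "u \<longlonglongrightarrow> u0" by (metis decseq_convergent)
    have "(\<lambda>n. u n + (\<Sum>k<n + N3. \<omega> k)) \<longlonglongrightarrow> u0 + suminf \<omega>"
      using LIMSEQ_ignore_initial_segment[OF summable_LIMSEQ[OF \<omega>(2)]] by (intro tendsto_add u0)
    hence "(\<lambda>n. \<rho> (n + N3)) \<longlonglongrightarrow> u0 + suminf \<omega>" by (simp add: u_def)
    then obtain r where r: "\<rho> \<longlonglongrightarrow> r" using LIMSEQ_offset by blast
    define \<delta> where "\<delta> = (\<beta> - \<alpha>) / 4"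
    have \<delta>: "\<delta> > 0" "\<beta> = \<alpha> + 4 * \<delta>" using \<alpha>\<beta> by (auto simp: \<delta>_def field_simps)
    have r\<omega>: "(\<lambda>n. \<rho> n + \<omega> n) \<longlonglongrightarrow> r" using tendsto_add[OF r \<omega>0] by simp
    have "r \<ge> \<beta>"
    proof (rule ccontr)
      assume "\<not> r \<ge> \<beta>"
      hence "\<forall>\<^sub>F n in sequentially. \<rho> n + \<omega> n < \<beta>" using r\<omega> by (intro order_tendstoD(2)[OF r\<omega>]) auto
      then obtain N4 where N4: "\<And>n. n \<ge> N4 \<Longrightarrow> \<rho> n + \<omega> n < \<beta>" by (auto simp: eventually_sequentially)
      obtain n where n: "n \<ge> Suc (max N3 N4)" "l n > \<beta>"
        using l(2) unfolding frequently_sequentially by blast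
      then obtain N where "n = Suc N" "N \<ge> N3" "N \<ge> N4" by (cases n) auto
      thus False using near[of N] N4[of N] n(2) by simp
    qed
    have "\<forall>\<^sub>F n in sequentially. \<rho> n < r + \<delta> \<and> \<rho> n > r - \<delta>"
      using \<delta> by (intro eventually_conj order_tendstoD[OF r]) auto
    then obtain N4 where N4: "\<And>n. n \<ge> N4 \<Longrightarrow> \<rho> n < r + \<delta> \<and> \<rho> n > r - \<delta>"
      by (auto simp: eventually_sequentially)
    obtain n where n: "n \<ge> Suc (max N3 N4)" "l n < \<alpha>"
      using l(1) unfolding frequently_sequentially by blast
    then obtain N where N: "n = Suc N" "N \<ge> N4" by (cases n) auto
    \<comment> \<open>A weight of at least 1/2 on a value below \<open>\<alpha>\<close> brings
      \<open>\<rho> (Suc N)\<close> down to the mean of \<open>\<rho> N\<close> and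
      \<open>\<alpha>\<close>. With \<open>\<rho> N < r + \<delta>\<close> and
      \<open>\<alpha> \<le> r - 4 * \<delta>\<close> this mean is less than
      \<open>r - \<delta>\<close>.\<close>
    have "\<rho> N \<ge> \<alpha>" using N4[OF N(2)] \<open>r \<ge> \<beta>\<close> \<delta> by linarith
    hence "(w N - 1/2) * (\<rho> N - \<alpha>) \<ge> 0" using w(1)[of N] by (intro mult_nonneg_nonneg) auto
    moreover have "w N * l (Suc N) \<le> w N * \<alpha>" using n(2) N(1) w(1)[of N] by (intro mult_left_mono) auto
    ultimately have "\<rho> (Suc N) \<le> (\<rho> N + \<alpha>) / 2" using step[of N] by (simp add: field_simps)
    thus False using N4[of N] N4[of "Suc N"] N(2) \<open>r \<ge> \<beta>\<close> \<delta> by auto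
  qed
qed

text \<open>What the growth argument uses of the numbers: \<open>L n\<close> stands for the binary
  logarithm of \<open>norm (\<alpha> 1 n)\<close>, and the bound \<open>M\<close> will come from the
  finite limsup.\<close>

locale height_growth =
  fixes D K :: nat and d :: "nat \<Rightarrow> nat" and L :: "nat \<Rightarrow> real" and a \<epsilon> M :: real
  assumes D: "D \<ge> 1" and K: "K \<ge> 1" and d: "\<And>n. n \<ge> 1 \<Longrightarrow> d n \<ge> 1"
    and a: "0 < a" "a < 1" and \<epsilon>: "\<epsilon> > 0" and M: "M \<ge> 1"
    and L_mono: "\<And>m n. 1 \<le> m \<Longrightarrow> m \<le> n \<Longrightarrow> L m \<le> L n"
    and L_ge: "\<And>n. n \<ge> 1 \<Longrightarrow> (1 + \<epsilon>) * log 2 (real n) \<le> L n"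
    and L_le: "\<And>n. n \<ge> 1 \<Longrightarrow> L n \<le> M * (real D ^ n * (\<Prod>i=1..n-1. real (K * (\<Prod>j=1..i. d j) + d i)))"
begin

definition Dp :: "nat \<Rightarrow> nat" where "Dp n = (\<Prod>i=1..n. d i)"

definition E :: "nat \<Rightarrow> real" where "E n = real D ^ n * (\<Prod>i=1..n-1. real (K * Dp i + d i))"

text \<open>
  \<open>V c N\<close> bounds \<open>-log\<^sub>2\<close> of the tail after \<open>N\<close>; \<open>\<rho> N\<close> is its main term relative to \<open>E (N + 1)\<close>.
\<close>

definition V :: "real \<Rightarrow> nat \<Rightarrow> real" where
  "V c N = real (D * Dp N) * (c + log 2 (real N + 1) + real K * (\<Sum>n=1..N. L n + 2 * L n powr a))"

definition \<rho> :: "nat \<Rightarrow> real" where "\<rho> N = real (D * Dp N) * (real K * (\<Sum>n=1..N. L n)) / E (Suc N)"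

text \<open>The share of the new term in the recursion for \<open>\<rho>\<close>: the part
  \<open>K * Dp (Suc N)\<close> of the factor by which \<open>E\<close> grows, apart from
  \<open>D\<close>.\<close>

definition w :: "nat \<Rightarrow> real" where "w N = K * Dp (Suc N) / (K * Dp (Suc N) + d (Suc N))"

section \<open>Growth of the exponents and the recursion for the main term\<close>

lemma Dp_Suc: "Dp (Suc n) = Dp n * d (Suc n)"
  by (simp add: Dp_def)

lemma Dp_pos: "Dp n \<ge> 1"
proof (induction n)
  case (Suc n)
  thus ?case using d[of "Suc n"] by (simp add: Dp_Suc Suc_le_eq)
qed (simp add: Dp_def)

lemma d_le_Dp: "n \<ge> 1 \<Longrightarrow> d n \<le> Dp n"
  using Dp_pos[of "n - 1"] by (cases n) (auto simp: Dp_Suc)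

lemma E_Suc: "n \<ge> 1 \<Longrightarrow> E (Suc n) = real D * (real K * real (Dp n) + real (d n)) * E n"
  by (cases n) (auto simp: E_def)

lemma E_pos: "E n > 0"
proof -
  have "0 < real (K * Dp i + d i)" for i using K Dp_pos[of i] by (subst of_nat_0_less_iff) simp
  thus ?thesis unfolding E_def using D
    by (intro mult_pos_pos prod_pos zero_less_power) auto
qed

text \<open>This absorbs the degree factor \<open>D * Dp n\<close> when lower order terms measured
  by \<open>E n\<close> are compared with \<open>E (Suc n)\<close>.\<close>

lemma D_Dp_E_le: "n \<ge> 1 \<Longrightarrow> real (D * Dp n) * E n \<le> E (Suc n)"
proof -
  assume "n \<ge> 1"
  have "real 1 * real (Dp n) \<le> real K * real (Dp n)" using K by (intro mult_right_mono) auto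
  hence "real D * real (Dp n) * E n \<le> real D * (real K * real (Dp n) + real (d n)) * E n"
    using E_pos[of n] by (intro mult_right_mono mult_left_mono) auto
  thus ?thesis by (simp add: E_Suc[OF \<open>n \<ge> 1\<close>])
qed

lemma E_double: "n \<ge> 1 \<Longrightarrow> 2 * E n \<le> E (Suc n)"
proof -
  assume n: "n \<ge> 1"
  have "1 * 1 \<le> K * Dp n" using K Dp_pos[of n] by (intro mult_mono) auto
  hence "2 \<le> K * Dp n + d n" using d[OF n] by linarith
  hence "1 * 2 \<le> D * (K * Dp n + d n)" using D by (intro mult_mono) auto
  hence "real 2 \<le> real (D * (K * Dp n + d n))" unfolding of_nat_le_iff by simp
  hence "2 * E n \<le> real (D * (K * Dp n + d n)) * E n"
    using E_pos[of n] by (intro mult_right_mono) auto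
  thus ?thesis by (simp add: E_Suc[OF n])
qed

lemma E_pow: "n \<ge> 1 \<Longrightarrow> 2 ^ k * E n \<le> E (n + k)"
proof (induction k)
  case (Suc k)
  thus ?case using E_double[of "n + k"] by simp
qed simp

lemma E_mono: "1 \<le> m \<Longrightarrow> m \<le> n \<Longrightarrow> E m \<le> E n"
proof -
  assume "1 \<le> m" "m \<le> n"
  have "1 * E m \<le> 2 ^ (n - m) * E m" using E_pos[of m] by (intro mult_right_mono) auto
  also have "\<dots> \<le> E n" using E_pow[of m "n - m"] \<open>1 \<le> m\<close> \<open>m \<le> n\<close> by simp
  finally show ?thesis by simp
qed

lemma E_ge: "n \<ge> 1 \<Longrightarrow> 2 ^ (n - 1) \<le> E n"
proof -
  assume "n \<ge> 1"
  have "1 \<le> E 1" using D by (simp add: E_def)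
  hence "2 ^ (n - 1) * 1 \<le> 2 ^ (n - 1) * E 1" by (intro mult_left_mono) auto
  also have "\<dots> \<le> E n" using E_pow[of 1 "n - 1"] \<open>n \<ge> 1\<close> by simp
  finally show ?thesis by simp
qed

lemma E_ge_1: "n \<ge> 1 \<Longrightarrow> 1 \<le> E n"
  using E_ge[of n] one_le_power[of "2::real" "n - 1"] by linarith

lemma L_le_E: "n \<ge> 1 \<Longrightarrow> L n \<le> M * E n"
  using L_le by (simp add: E_def Dp_def)

lemma L_nonneg: "n \<ge> 1 \<Longrightarrow> 0 \<le> L n"
  using L_ge[of n] \<epsilon> by (smt (verit) mult_nonneg_nonneg one_le_log_cancel_iff real_of_nat_ge_one_iff zero_le_log_cancel_iff)

lemma \<rho>_nonneg: "\<rho> n \<ge> 0"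
  unfolding \<rho>_def using E_pos L_nonneg
  by (intro divide_nonneg_pos mult_nonneg_nonneg sum_nonneg) auto

lemma w_bounds: "1 / 2 \<le> w N" "w N \<le> 1"
proof -
  have "real (d (Suc N)) \<le> 1 * real (Dp (Suc N))" using d_le_Dp[of "Suc N"] by simp
  also have "\<dots> \<le> real K * real (Dp (Suc N))" using K by (intro mult_right_mono) auto
  finally show "1 / 2 \<le> w N" "w N \<le> 1"
    using d[of "Suc N"] by (auto simp: w_def field_simps)
qed

text \<open>Since \<open>E (Suc (Suc N))\<close> is \<open>D * Q * E (Suc N)\<close>, the new term
  \<open>L (Suc N)\<close> receives exactly the weight \<open>w N\<close>. The old sum appears in
  \<open>(1 - w N) * \<rho> N\<close> with an additional factor \<open>D\<close>, which is where
  equality becomes an inequality.\<close>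

lemma \<rho>_step: "\<rho> (Suc N) \<le> (1 - w N) * \<rho> N + w N * (L (Suc N) / E (Suc N))"
proof -
  define Q where "Q = real K * real (Dp (Suc N)) + real (d (Suc N))"
  have "d (Suc N) > 0" using d[of "Suc N"] by simp
  hence Q: "Q > 0" unfolding Q_def by (intro add_nonneg_pos) auto
  define s where "s = (\<Sum>n=1..N. L n)"
  have s: "s \<ge> 0" unfolding s_def using L_nonneg by (intro sum_nonneg) auto
  have D1: "real D \<ge> 1" "real D > 0" using D by auto
  have E: "E (Suc N) > 0" by (rule E_pos)
  have 1: "\<rho> (Suc N) = real (Dp (Suc N)) * real K * s / (Q * E (Suc N)) + w N * (L (Suc N) / E (Suc N))"
  proof -
    have ES: "E (Suc (Suc N)) = real D * Q * E (Suc N)" by (simp add: E_Suc Q_def)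
    have wQ: "w N = real K * real (Dp (Suc N)) / Q" by (simp add: w_def Q_def)
    have "(\<Sum>n=1..Suc N. L n) = s + L (Suc N)" by (simp add: s_def)
    thus ?thesis using D1 Q E unfolding \<rho>_def ES wQ by (simp add: field_simps)
  qed
  have w1: "1 - w N = real (d (Suc N)) / Q"
    using Q unfolding w_def Q_def by (simp add: field_simps)
  have 2: "(1 - w N) * \<rho> N = D * (real (Dp (Suc N)) * real K * s / (Q * E (Suc N)))"
    unfolding w1 \<rho>_def using Q E by (simp add: s_def Dp_Suc field_simps)
  have "1 * (real (Dp (Suc N)) * real K * s / (Q * E (Suc N))) \<le> (1 - w N) * \<rho> N"
    unfolding 2 using D1 s Q E by (intro mult_right_mono) auto
  thus ?thesis unfolding 1 by simp
qed

lemma \<rho>_le: "\<rho> n \<le> M"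
proof (induction n)
  case 0
  thus ?case using M by (simp add: \<rho>_def)
next
  case (Suc n)
  have "L (Suc n) / E (Suc n) \<le> M" using L_le_E[of "Suc n"] E_pos[of "Suc n"] by (simp add: field_simps)
  hence "w n * (L (Suc n) / E (Suc n)) \<le> w n * M" using w_bounds[of n] by (intro mult_left_mono) auto
  moreover have "(1 - w n) * \<rho> n \<le> (1 - w n) * M" using Suc w_bounds[of n] by (intro mult_left_mono) auto
  ultimately show ?case using \<rho>_step[of n] by (simp add: algebra_simps)
qed

text \<open>The geometric factor bounds \<open>E N powr (a - 1)\<close> through \<open>E_ge\<close>;
  the factor \<open>N\<close> counts the summands of the lower order terms.\<close>

definition \<omega> :: "real \<Rightarrow> nat \<Rightarrow> real" where "\<omega> B N = B * (real N * (2 powr (a - 1)) ^ (N - 1))"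

lemma summable_\<omega>: "summable (\<omega> B)"
proof -
  have "norm (2 powr (a - 1) :: real) < 1" using a by (simp add: powr_less_one)
  hence "summable (\<lambda>n. of_nat (Suc n) * (2 powr (a - 1) :: real) ^ n)"
    by (intro sums_summable[OF geometric_deriv_sums])
  hence "summable (\<lambda>n. \<omega> B (Suc n))" unfolding \<omega>_def
    by (intro summable_mult) (simp add: mult.commute)
  thus ?thesis by (simp only: summable_Suc_iff)
qed

text \<open>All terms other than the main one are at most a constant times
  \<open>N * q * E (Suc N)\<close>, where \<open>E N * q = E N powr a\<close>. In \<open>B\<close>,
  the part \<open>c + 1 + 2 * K * M\<close> comes from \<open>V\<close>, the part
  \<open>log 2 (2 * C) + 1\<close> from the logarithm, and \<open>2 * M\<close> from the power of
  \<open>L (Suc N)\<close>.\<close>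

lemma V_le:
  assumes c: "c \<ge> 0" and C: "C \<ge> 1" and N: "N \<ge> 1"
  defines "B \<equiv> c + 2 + 2 * K * M + log 2 (2 * C) + 2 * M"
  shows "V c N + log 2 (2 * C * N) + 2 * L (Suc N) powr a \<le> E (Suc N) * (\<rho> N + \<omega> B N)"
proof -
  define q where "q = E N powr (a - 1)"
  have EN: "E N \<ge> 1" "E N > 0" using E_ge_1[OF N] by auto
  have ES: "E (Suc N) \<ge> 1" "E N \<le> E (Suc N)" using E_ge_1[of "Suc N"] E_mono[of N "Suc N"] N by auto
  have q0: "q > 0" using EN by (simp add: q_def)
  have "q \<le> (2 ^ (N - 1)) powr (a - 1)" unfolding q_def
    using E_ge[OF N] a by (intro powr_mono2') auto
  also have "\<dots> = (2 powr (a - 1)) ^ (N - 1)"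
    by (simp add: powr_realpow[symmetric] powr_powr mult.commute)
  finally have q: "q \<le> (2 powr (a - 1)) ^ (N - 1)" .
  have Eq: "E N * q = E N powr a" using EN by (simp add: q_def powr_diff)
  have Ea: "E N powr a \<ge> 1" using EN a by (simp add: ge_one_powr_ge_zero)
  have pow: "x powr a \<le> M * y powr a" if "0 \<le> x" "x \<le> M * y" "y > 0" for x y
  proof -
    have "x powr a \<le> (M * y) powr a" using that a by (intro powr_mono2) auto
    also have "\<dots> = M powr a * y powr a" using M that by (simp add: powr_mult)
    also have "M powr a \<le> M powr 1" using M a by (intro powr_mono) auto
    finally show ?thesis using M by (simp add: mult_right_mono)
  qed
  have N1: "log 2 (real N + 1) \<le> N"
  proof -
    have "real N + 1 \<le> 2 ^ N" using of_nat_mono[OF Suc_leI[OF less_exp[of N]], where 'a = real] by simp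
    hence "log 2 (real N + 1) \<le> log 2 (2 ^ N)" by (intro log_mono) auto
    thus ?thesis by simp
  qed
  have "log 2 (real N) \<le> log 2 (real N + 1)" using N by (intro log_mono) auto
  hence "log 2 (real N) \<le> N" using N1 by simp
  moreover have "log 2 (2 * C * N) = log 2 (2 * C) + log 2 N" using C N by (subst log_mult) auto
  ultimately have N2: "log 2 (2 * C * N) \<le> log 2 (2 * C) + N" by simp
  have N0: "real N \<ge> 1" using N by simp
  have lC: "log 2 (2 * C) \<ge> 0" using C by simp
  have EqS: "1 \<le> E (Suc N) * q"
  proof -
    have "1 \<le> E N * q" using Eq Ea by simp
    also have "\<dots> \<le> E (Suc N) * q" using ES q0 by (intro mult_right_mono) auto
    finally show ?thesis .
  qed
  have "(\<Sum>n=1..N. L n powr a) \<le> (\<Sum>n=1..N. M * E N powr a)"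
  proof (intro sum_mono pow)
    fix n assume n: "n \<in> {1..N}"
    show "0 \<le> L n" using n by (intro L_nonneg) auto
    have "L n \<le> L N" using n by (intro L_mono) auto
    thus "L n \<le> M * E N" using L_le_E[OF N] by simp
  qed (rule EN)
  hence s: "(\<Sum>n=1..N. L n powr a) \<le> N * (M * E N powr a)" by simp
  \<comment> \<open>The bracket in \<open>V\<close> without its main term, the sum of the
    \<open>L n\<close>.\<close>
  define X where "X = c + log 2 (real N + 1) + 2 * K * (\<Sum>n=1..N. L n powr a)"
  have "X \<le> c * N * E N powr a + N * E N powr a + 2 * K * (N * (M * E N powr a))"
    unfolding X_def
  proof (intro add_mono mult_left_mono s)
    have NE: "1 * 1 \<le> real N * E N powr a" using N0 Ea by (intro mult_mono) auto
    show "c \<le> c * N * E N powr a" using mult_left_mono[OF NE c] by (simp add: mult.assoc)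
    have "real N * 1 \<le> real N * E N powr a" using Ea by (intro mult_left_mono) auto
    thus "log 2 (real N + 1) \<le> real N * E N powr a" using N1 by simp
  qed simp
  also have "\<dots> = E N * (N * (c + 1 + 2 * K * M) * q)"
    unfolding Eq[symmetric] by (simp add: algebra_simps)
  finally have X: "X \<le> E N * (N * (c + 1 + 2 * K * M) * q)" .
  have "real (D * Dp N) * X \<le> real (D * Dp N) * (E N * (N * (c + 1 + 2 * K * M) * q))"
    using X by (intro mult_left_mono) auto
  also have "\<dots> = real (D * Dp N) * E N * (N * (c + 1 + 2 * K * M) * q)" by simp
  also have "\<dots> \<le> E (Suc N) * (N * (c + 1 + 2 * K * M) * q)"
    using c M q0 by (intro mult_right_mono D_Dp_E_le N) auto
  finally have 1: "real (D * Dp N) * X \<le> E (Suc N) * q * (N * (c + 1 + 2 * K * M))"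
    by (simp add: mult_ac)
  have "log 2 (2 * C * N) \<le> log 2 (2 * C) * N + N"
    using N2 mult_left_mono[OF N0 lC] by simp
  also have "\<dots> = 1 * (N * (log 2 (2 * C) + 1))" by (simp add: algebra_simps)
  also have "\<dots> \<le> E (Suc N) * q * (N * (log 2 (2 * C) + 1))"
    using EqS lC by (intro mult_right_mono) auto
  finally have 2: "log 2 (2 * C * N) \<le> E (Suc N) * q * (N * (log 2 (2 * C) + 1))" .
  have "L (Suc N) powr a \<le> M * E (Suc N) powr a"
    using L_nonneg[of "Suc N"] L_le_E[of "Suc N"] E_pos by (intro pow) auto
  also have "E (Suc N) powr a = E (Suc N) * E (Suc N) powr (a - 1)" using ES by (simp add: powr_diff)
  also have "M * \<dots> \<le> M * (E (Suc N) * q)" unfolding q_def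
    using M ES EN a by (intro mult_left_mono powr_mono2') auto
  also have "\<dots> = E (Suc N) * q * (1 * M)" by simp
  also have "\<dots> \<le> E (Suc N) * q * (N * M)"
    using N0 M EqS by (intro mult_left_mono mult_right_mono) auto
  finally have 3: "2 * L (Suc N) powr a \<le> E (Suc N) * q * (N * (2 * M))" by (simp add: mult_ac)
  have "V c N = real (D * Dp N) * (real K * (\<Sum>n=1..N. L n)) + real (D * Dp N) * X"
    by (simp add: V_def X_def sum.distrib sum_distrib_left algebra_simps)
  also have "real (D * Dp N) * (real K * (\<Sum>n=1..N. L n)) = E (Suc N) * \<rho> N"
    using E_pos[of "Suc N"] by (simp add: \<rho>_def)
  finally have "V c N + log 2 (2 * C * N) + 2 * L (Suc N) powr a \<le> E (Suc N) * \<rho> N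
     + (E (Suc N) * q * (N * (c + 1 + 2 * K * M)) + E (Suc N) * q * (N * (log 2 (2 * C) + 1))
     + E (Suc N) * q * (N * (2 * M)))"
    using 1 2 3 by linarith
  also have "\<dots> = E (Suc N) * (\<rho> N + B * (N * q))" by (simp add: B_def algebra_simps)
  also have "\<dots> \<le> E (Suc N) * (\<rho> N + \<omega> B N)"
    unfolding \<omega>_def using ES q c M lC
    by (intro mult_left_mono add_mono order_refl) (auto simp: B_def)
  finally show ?thesis .
qed

text \<open>Monotonicity spreads the bound for \<open>L n\<close> to all indices between
  \<open>N\<close> and \<open>n\<close>, so the sum up to \<open>n\<close> is at most
  \<open>n + 1\<close> times that bound. Meanwhile \<open>E n\<close> has grown by at least
  \<open>2 ^ (n - Suc N)\<close>, and \<open>n > 2 * N\<close> makes this outweigh the factor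
  \<open>n + 1\<close>.\<close>

lemma far_bounds:
  assumes c: "c \<ge> 0" and N: "N \<ge> 1" and n: "n > 2 * N" and C: "C \<ge> 1"
    and Ln: "L n \<le> C * V c N" and VW: "V c N \<le> E (Suc N) * W"
  shows "\<rho> n \<le> C * (2 * N + 2) / 2 ^ N * W" "\<And>m. m \<in> {N<..n} \<Longrightarrow> L m / E m \<le> C * W"
proof -
  have EN: "E (Suc N) > 0" by (rule E_pos)
  have V0: "V c N \<ge> 0" unfolding V_def using c L_nonneg
    by (intro mult_nonneg_nonneg add_nonneg_nonneg sum_nonneg) auto
  hence W0: "W \<ge> 0" using VW EN by (meson order_trans zero_le_mult_iff not_le)
  have LV: "L m \<le> C * V c N" if "m \<in> {N<..n}" for m
    using Ln L_mono[of m n] that by auto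
  show "L m / E m \<le> C * W" if m: "m \<in> {N<..n}" for m
  proof -
    have "E (Suc N) \<le> E m" using m by (intro E_mono) auto
    hence "E (Suc N) * W \<le> E m * W" using W0 by (intro mult_right_mono)
    hence "V c N \<le> E m * W" using VW by simp
    hence "C * V c N \<le> C * (E m * W)" using C by (intro mult_left_mono) auto
    thus ?thesis using LV[OF m] E_pos[of m] by (simp add: field_simps)
  qed
  have n1: "n \<ge> 1" using n by simp
  have "real 1 * (\<Sum>i=1..N. L i) \<le> real (D * Dp N * K) * (\<Sum>i=1..N. L i)"
    using D Dp_pos[of N] K L_nonneg
    by (intro mult_right_mono sum_nonneg) (auto simp: Suc_le_eq simp flip: of_nat_mult)
  also have "\<dots> \<le> V c N"
    unfolding V_def of_nat_mult[of "D * Dp N"] mult.assoc[of "real (D * Dp N)"]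
  proof (intro mult_left_mono)
    have "(\<Sum>i=1..N. L i) \<le> (\<Sum>i=1..N. L i + 2 * L i powr a)" by (intro sum_mono) auto
    hence "K * (\<Sum>i=1..N. L i) \<le> K * (\<Sum>i=1..N. L i + 2 * L i powr a)" by (intro mult_left_mono) auto
    moreover have "log 2 (real N + 1) \<ge> 0" by simp
    ultimately show "real K * (\<Sum>i=1..N. L i) \<le> c + log 2 (real N + 1) + real K * (\<Sum>n=1..N. L n + 2 * L n powr a)"
      using c by linarith
  qed simp
  also have "\<dots> \<le> C * V c N" using mult_right_mono[OF C V0] by simp
  finally have 1: "(\<Sum>i=1..N. L i) \<le> C * V c N" by simp
  have "{1..n} = {1..N} \<union> {N<..n}" using n by auto
  hence "(\<Sum>i=1..n. L i) = (\<Sum>i=1..N. L i) + (\<Sum>i\<in>{N<..n}. L i)"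
    by (simp only:) (intro sum.union_disjoint; auto)
  also have "(\<Sum>i\<in>{N<..n}. L i) \<le> (\<Sum>i\<in>{N<..n}. C * V c N)" by (intro sum_mono LV)
  also have "\<dots> = real (n - N) * (C * V c N)" by simp
  also have "\<dots> \<le> real n * (C * V c N)" using C V0 by (intro mult_right_mono) auto
  finally have S: "(\<Sum>i=1..n. L i) \<le> (n + 1) * (C * V c N)" using 1 by (simp add: algebra_simps)
  define S where "S = (\<Sum>i=1..n. L i)"
  have S0: "S \<ge> 0" unfolding S_def using L_nonneg by (intro sum_nonneg) auto
  have "\<rho> n = real K * real (Dp n) / (real K * real (Dp n) + real (d n)) * (S / E n)"
    using D unfolding \<rho>_def E_Suc[OF n1] S_def by simp
  also have "\<dots> \<le> 1 * (S / E n)"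
    using E_pos[of n] S0 d[OF n1] K Dp_pos[of n]
    by (intro mult_right_mono) (auto intro!: divide_le_eq_1[THEN iffD2] disjI1 add_nonneg_pos)
  also have "\<dots> \<le> (n + 1) * (C * (E (Suc N) * W)) / E n"
  proof -
    have "S \<le> (n + 1) * (C * V c N)" using S by (simp add: S_def)
    also have "\<dots> \<le> (n + 1) * (C * (E (Suc N) * W))" using VW C by (intro mult_left_mono) auto
    finally show ?thesis using E_pos[of n] by (simp add: divide_right_mono)
  qed
  also have "\<dots> \<le> C * (2 * N + 2) / 2 ^ N * W"
  proof -
    \<comment> \<open>Equality holds at \<open>n = 2 * N + 1\<close>; each further step doubles the
      right side and at most doubles the left one.\<close>
    have "real (n + 1) * 2 ^ N \<le> real (2 * N + 2) * 2 ^ (n - Suc N)"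
    proof -
      have "Suc (2 * N) \<le> n" using n by simp
      thus ?thesis
      proof (induction n rule: dec_induct)
        case (step m)
        have "real (Suc m + 1) * 2 ^ N \<le> 2 * (real (m + 1) * 2 ^ N)" by simp
        also have "\<dots> \<le> 2 * (real (2 * N + 2) * 2 ^ (m - Suc N))" using step.IH by simp
        also have "\<dots> = real (2 * N + 2) * 2 ^ Suc (m - Suc N)" by simp
        also have "Suc (m - Suc N) = Suc m - Suc N" using step by simp
        finally show ?case .
      qed (simp add: algebra_simps)
    qed
    hence "real (n + 1) * 2 ^ N * E (Suc N) \<le> real (2 * N + 2) * 2 ^ (n - Suc N) * E (Suc N)"
      using EN by (intro mult_right_mono) auto
    also have "\<dots> \<le> real (2 * N + 2) * E n"
      unfolding mult.assoc using E_pow[of "Suc N" "n - Suc N"] n by (intro mult_left_mono) auto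
    finally have "real (n + 1) * 2 ^ N * E (Suc N) * (C * W) \<le> real (2 * N + 2) * E n * (C * W)"
      using C W0 by (intro mult_right_mono) auto
    thus ?thesis using E_pos[of n] by (simp add: field_simps)
  qed
  finally show "\<rho> n \<le> C * (2 * N + 2) / 2 ^ N * W" .
qed

section \<open>Size of the tail of the series\<close>

lemma L_at_top: "filterlim L at_top sequentially"
proof (rule filterlim_at_top_mono)
  show "filterlim (\<lambda>n. (1 + \<epsilon>) * log 2 (real n)) at_top sequentially"
    using \<epsilon> by real_asymp
  show "\<forall>\<^sub>F n in sequentially. (1 + \<epsilon>) * log 2 (real n) \<le> L n"
    using L_ge by (auto simp: eventually_sequentially)
qed

text \<open>For \<open>y \<ge> x\<close> and \<open>a < 1\<close>, \<open>y powr a\<close> lies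
  below the line \<open>x powr (a - 1) * y\<close>. Hence \<open>2 * y powr a\<close> grows by at
  most \<open>2 * x powr (a - 1) * (y - x)\<close>, which is at most \<open>y - x\<close>.\<close>

lemma powr_diff_mono:
  assumes "0 < x" "2 * x powr (a - 1) \<le> 1" "x \<le> y"
  shows "x - 2 * x powr a \<le> y - 2 * y powr a"
proof -
  have "y powr a = x powr a * (y / x) powr a" using assms by (simp add: powr_divide)
  also have "(y / x) powr a \<le> (y / x) powr 1" using assms a by (intro powr_mono) auto
  hence "x powr a * (y / x) powr a \<le> x powr a * (y / x)"
    using assms by (intro mult_left_mono) auto
  also have "\<dots> = x powr (a - 1) * y" using assms by (simp add: powr_diff)
  finally have "y powr a \<le> x powr (a - 1) * y" .
  moreover have "x powr a = x powr (a - 1) * x" using assms by (simp add: powr_diff)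
  moreover have "2 * x powr (a - 1) * (y - x) \<le> 1 * (y - x)"
    using assms by (intro mult_right_mono) auto
  ultimately show ?thesis by (simp add: algebra_simps)
qed

text \<open>One portion \<open>\<eta> * L n\<close> absorbs \<open>2 * L n powr a\<close> and a
  second one is kept as a decay factor; what remains still gives the convergent exponent
  \<open>1 + \<epsilon> / 2\<close>.\<close>

definition \<eta> :: real where "\<eta> = \<epsilon> / (4 * (1 + \<epsilon>))"

lemma \<eta>: "0 < \<eta>" "\<eta> < 1" "(1 + \<epsilon>) * (1 - 2 * \<eta>) = 1 + \<epsilon> / 2"
  using \<epsilon> by (auto simp: \<eta>_def field_simps)

lemma eventually_L_large:
  "\<forall>\<^sub>F n in sequentially. n \<ge> 1 \<and> L n > 0 \<and> 2 * L n powr a \<le> \<eta> * L n \<and> 2 * L n powr (a - 1) \<le> 1"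
proof -
  have "((\<lambda>x. 2 * x powr (a - 1)) \<longlongrightarrow> 2 * 0) at_top"
    using a by (intro tendsto_intros tendsto_neg_powr) (auto simp: filterlim_ident)
  hence "\<forall>\<^sub>F x in at_top. 2 * x powr (a - 1) < \<eta>"
    using \<eta> by (intro order_tendstoD(2)[where y = "2 * 0"]) auto
  hence "\<forall>\<^sub>F x in at_top. x > 0 \<and> 2 * x powr a \<le> \<eta> * x \<and> 2 * x powr (a - 1) \<le> 1"
    using eventually_gt_at_top[of 0]
  proof eventually_elim
    case (elim x)
    have "x powr a = x powr (a - 1) * x" using elim by (simp add: powr_diff)
    moreover have "2 * x powr (a - 1) * x \<le> \<eta> * x" using elim by (intro mult_right_mono) auto
    ultimately show ?case using elim \<eta> by simp
  qed
  from eventually_compose_filterlim[OF this L_at_top] eventually_ge_at_top[of 1]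
  show ?thesis by eventually_elim auto
qed

text \<open>
  The factor \<open>2 powr (- \<eta> L\<^sub>n)\<close> pays for the distance of \<open>L\<^sub>n\<close> from the bound, the other one
  for the convergence of the series.
\<close>

lemma powr_neg_L_le:
  assumes "n \<ge> 1" "2 * L n powr a \<le> \<eta> * L n"
  shows "2 powr (- (L n - 2 * L n powr a)) \<le> 2 powr (- \<eta> * L n) * real n powr (- (1 + \<epsilon> / 2))"
proof -
  have "(1 - 2 * \<eta>) * ((1 + \<epsilon>) * log 2 n) \<le> (1 - 2 * \<eta>) * L n"
    using L_ge[OF assms(1)] \<epsilon> by (intro mult_left_mono) (auto simp: \<eta>_def field_simps)
  also have "(1 - 2 * \<eta>) * ((1 + \<epsilon>) * log 2 n) = (1 + \<epsilon> / 2) * log 2 n"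
    unfolding \<eta>(3)[symmetric] by simp
  finally have "- (L n - 2 * L n powr a) \<le> - \<eta> * L n + log 2 n * (- (1 + \<epsilon> / 2))"
    using assms(2) by (simp add: algebra_simps)
  hence "2 powr (- (L n - 2 * L n powr a)) \<le> 2 powr (- \<eta> * L n + log 2 n * (- (1 + \<epsilon> / 2)))"
    by (intro powr_mono) auto
  also have "\<dots> = 2 powr (- \<eta> * L n) * (2 powr (log 2 n)) powr (- (1 + \<epsilon> / 2))"
    by (simp only: powr_add powr_powr)
  also have "2 powr (log 2 n) = n" using assms(1) by simp
  finally show ?thesis .
qed

lemma summable_neg_powr: "summable (\<lambda>n. real n powr (- (1 + \<epsilon> / 2)))"
  using \<epsilon> by (simp add: summable_real_powr_iff)

lemma summable_powr_neg_L: "summable (\<lambda>n. 2 powr (- (L n - 2 * L n powr a)))"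
proof (rule summable_comparison_test_ev[OF _ summable_neg_powr])
  show "\<forall>\<^sub>F n in sequentially. norm (2 powr (- (L n - 2 * L n powr a))) \<le> real n powr (- (1 + \<epsilon> / 2))"
    using eventually_L_large
  proof eventually_elim
    case (elim n)
    have "2 powr (- \<eta> * L n) \<le> 2 powr 0" using elim \<eta> by (intro powr_mono) auto
    hence "2 powr (- \<eta> * L n) * real n powr (- (1 + \<epsilon> / 2)) \<le> 1 * real n powr (- (1 + \<epsilon> / 2))"
      by (intro mult_right_mono) auto
    with powr_neg_L_le[of n] elim
    have "2 powr (- (L n - 2 * L n powr a)) \<le> real n powr (- (1 + \<epsilon> / 2))" by linarith
    thus ?case by simp
  qed
qed

text \<open>If both alternatives fail, the next \<open>N\<close> terms are each below
  \<open>2 powr (- v) / (2 * C * N)\<close>, and the terms beyond have size at most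
  \<open>2 powr (- v)\<close> times the terms of a convergent series with small tail. Each part is
  at most half of what the lower bound for the tail requires, the first one strictly less.\<close>

lemma tail_dichotomy:
  assumes C: "C \<ge> 1"
  shows "\<exists>N0\<ge>1. \<forall>N\<ge>N0. \<forall>v. 2 powr (- v) \<le> C * (\<Sum>n. 2 powr (- (L (n + Suc N) - 2 * L (n + Suc N) powr a))) \<longrightarrow>
    L (Suc N) - 2 * L (Suc N) powr a \<le> v + log 2 (2 * C * N) \<or> (\<exists>n>2 * N. L n \<le> 1 / \<eta> * v)"
proof -
  define u where "u n = 2 powr (- (L n - 2 * L n powr a))" for n
  define s where "s n = real n powr (- (1 + \<epsilon> / 2))" for n
  have s: "summable s" using summable_neg_powr by (simp add: s_def[abs_def])
  have u: "summable u" using summable_powr_neg_L by (simp add: u_def[abs_def])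
  obtain N1 where N1: "\<And>n. n \<ge> N1 \<Longrightarrow> norm (\<Sum>i. s (i + n)) < 1 / (2 * C)"
    using suminf_exist_split[OF _ s, of "1 / (2 * C)"] C by auto
  obtain N2 where N2: "\<And>n. n \<ge> N2 \<Longrightarrow> n \<ge> 1 \<and> L n > 0 \<and> 2 * L n powr a \<le> \<eta> * L n \<and> 2 * L n powr (a - 1) \<le> 1"
    using eventually_L_large unfolding eventually_sequentially by blast
  show ?thesis
  proof (intro exI[of _ "max 1 (max N1 N2)"] conjI allI impI)
    fix N v
    assume N: "N \<ge> max 1 (max N1 N2)"
      and *: "2 powr (- v) \<le> C * (\<Sum>n. 2 powr (- (L (n + Suc N) - 2 * L (n + Suc N) powr a)))"
    show "L (Suc N) - 2 * L (Suc N) powr a \<le> v + log 2 (2 * C * N) \<or> (\<exists>n>2 * N. L n \<le> 1 / \<eta> * v)"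
    proof (rule ccontr)
      assume "\<not> ?thesis"
      hence near: "L (Suc N) - 2 * L (Suc N) powr a > v + log 2 (2 * C * N)"
        and far: "\<And>n. n > 2 * N \<Longrightarrow> L n > 1 / \<eta> * v" by (auto simp: not_le)
      have N0: "real N > 0" using N by simp
      \<comment> \<open>These are the indices from \<open>N + 1\<close> to \<open>2 * N\<close>, so
        the rest of the tail starts exactly where the negated far alternative applies.\<close>
      have "(\<Sum>i<N. u (i + Suc N)) \<le> (\<Sum>i<N. u (Suc N))"
      proof (intro sum_mono)
        fix i
        have "L (Suc N) \<le> L (i + Suc N)" by (intro L_mono) auto
        hence "L (Suc N) - 2 * L (Suc N) powr a \<le> L (i + Suc N) - 2 * L (i + Suc N) powr a"
          using N2[of "Suc N"] N by (intro powr_diff_mono) auto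
        thus "u (i + Suc N) \<le> u (Suc N)" unfolding u_def by (intro powr_mono) auto
      qed
      also have "\<dots> = N * u (Suc N)" by simp
      also have "u (Suc N) < 2 powr (- (v + log 2 (2 * C * N)))"
        unfolding u_def using near by (intro powr_less_mono) auto
      also have "\<dots> = 2 powr (- v) / 2 powr (log 2 (2 * C * N))"
        by (simp add: powr_diff)
      also have "2 powr (log 2 (2 * C * N)) = 2 * C * N" using C N0 by (intro powr_log_cancel) auto
      finally have 1: "(\<Sum>i<N. u (i + Suc N)) < 2 powr (- v) / (2 * C)" using N0 by (simp add: mult_ac)
      have u_le: "u (i + N + Suc N) \<le> 2 powr (- v) * s (i + N + Suc N)" for i
      proof -
        define n where "n = i + N + Suc N"
        have n: "n > 2 * N" "n \<ge> N2" "n \<ge> 1" using N by (auto simp: n_def)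
        have "- \<eta> * L n \<le> - v" using far[OF n(1)] \<eta> by (simp add: field_simps)
        hence "2 powr (- \<eta> * L n) * s n \<le> 2 powr (- v) * s n"
          by (intro mult_right_mono powr_mono) (auto simp: s_def)
        moreover have "u n \<le> 2 powr (- \<eta> * L n) * s n"
          unfolding u_def s_def using N2[OF n(2)] by (intro powr_neg_L_le) auto
        ultimately show ?thesis unfolding n_def[symmetric] by linarith
      qed
      have s': "summable (\<lambda>i. s (i + N + Suc N))" and u': "summable (\<lambda>i. u (i + N + Suc N))"
        "summable (\<lambda>i. u (i + Suc N))"
        using s u by (simp_all add: add.assoc summable_ignore_initial_segment del: add_Suc_right)
      have "(\<Sum>i. u (i + N + Suc N)) \<le> (\<Sum>i. 2 powr (- v) * s (i + N + Suc N))"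
        by (intro suminf_le u_le u' summable_mult s')
      also have "\<dots> = 2 powr (- v) * (\<Sum>i. s (i + N + Suc N))" by (rule suminf_mult[OF s'])
      also have "(\<Sum>i. s (i + N + Suc N)) \<le> 1 / (2 * C)"
        using N1[of "N + Suc N"] N by (simp add: add.assoc abs_less_iff)
      finally have 2: "(\<Sum>i. u (i + N + Suc N)) \<le> 2 powr (- v) / (2 * C)" by simp
      have "(\<Sum>i. u (i + Suc N)) = (\<Sum>i. u (i + N + Suc N)) + (\<Sum>i<N. u (i + Suc N))"
        by (rule suminf_split_initial_segment[OF u'(2)])
      also have "\<dots> < 2 powr (- v) / (2 * C) + 2 powr (- v) / (2 * C)" using 1 2 by linarith
      also have "\<dots> = 2 powr (- v) / C" by simp
      finally have "C * (\<Sum>i. u (i + Suc N)) < 2 powr (- v)" using C by (simp add: field_simps)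
      thus False using * by (simp add: u_def)
    qed
  qed simp
qed

text \<open>With \<open>v = V c N\<close>, the first alternative of \<open>tail_dichotomy\<close>
  becomes the near case by \<open>V_le\<close>, and the second becomes the far case by
  \<open>far_bounds\<close>, whose decaying factor is \<open>g\<close>.\<close>

lemma growth_contradiction:
  assumes c: "c \<ge> 0" and C: "C \<ge> 1"
    and bound: "\<And>N. N \<ge> N0 \<Longrightarrow>
      2 powr (- V c N) \<le> C * (\<Sum>n. 2 powr (- (L (n + Suc N) - 2 * L (n + Suc N) powr a)))"
    and x: "x < y" "0 < y"
    and l: "\<exists>\<^sub>F n in sequentially. L n / E n < x" "\<exists>\<^sub>F n in sequentially. L n / E n > y"
  shows False
proof -
  define B where "B = c + 2 + 2 * K * M + log 2 (2 * C) + 2 * M"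
  have B: "B \<ge> 0" unfolding B_def using c C M by (intro add_nonneg_nonneg mult_nonneg_nonneg) auto
  define C' where "C' = 1 / \<eta>"
  have C': "C' \<ge> 1" using \<eta> by (simp add: C'_def)
  obtain N1 where N1: "N1 \<ge> 1" "\<And>N v. N \<ge> N1 \<Longrightarrow> 2 powr (- v) \<le> C * (\<Sum>n. 2 powr (- (L (n + Suc N) - 2 * L (n + Suc N) powr a))) \<Longrightarrow>
    L (Suc N) - 2 * L (Suc N) powr a \<le> v + log 2 (2 * C * N) \<or> (\<exists>n>2 * N. L n \<le> C' * v)"
    using tail_dichotomy[OF C] unfolding C'_def by blast
  define g where "g N = C' * (2 * real N + 2) / 2 ^ N" for N
  have g: "g \<longlonglongrightarrow> 0" unfolding g_def by real_asymp
  have nf: "L (Suc N) / E (Suc N) \<le> \<rho> N + \<omega> B N \<or>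
      (\<exists>n>N. \<rho> n \<le> g N * (\<rho> N + \<omega> B N) \<and> (\<forall>m\<in>{N<..n}. L m / E m \<le> C' * (\<rho> N + \<omega> B N)))"
    if N: "N \<ge> max N0 N1" for N
  proof -
    have N': "N \<ge> 1" using N N1(1) by simp
    have V: "V c N + log 2 (2 * C * N) + 2 * L (Suc N) powr a \<le> E (Suc N) * (\<rho> N + \<omega> B N)"
      unfolding B_def by (rule V_le[OF c C N'])
    have "1 * 1 \<le> 2 * C * N" using C N' by (intro mult_mono) auto
    hence "log 2 (2 * C * N) \<ge> 0" by simp
    hence V': "V c N \<le> E (Suc N) * (\<rho> N + \<omega> B N)" using V powr_ge_zero[of "L (Suc N)" a] by linarith
    have "L (Suc N) - 2 * L (Suc N) powr a \<le> V c N + log 2 (2 * C * N) \<or> (\<exists>n>2 * N. L n \<le> C' * V c N)"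
      using N by (intro N1(2) bound) auto
    thus ?thesis
    proof
      assume "L (Suc N) - 2 * L (Suc N) powr a \<le> V c N + log 2 (2 * C * N)"
      hence "L (Suc N) \<le> E (Suc N) * (\<rho> N + \<omega> B N)" using V by linarith
      thus ?thesis using E_pos[of "Suc N"] by (simp add: field_simps)
    next
      assume "\<exists>n>2 * N. L n \<le> C' * V c N"
      then obtain n where n: "n > 2 * N" "L n \<le> C' * V c N" by blast
      from far_bounds[OF c N' n(1) C' n(2) V'] n(1)
      show ?thesis unfolding g_def by (intro disjI2 exI[of _ n]) (auto simp: add.commute)
    qed
  qed
  have "\<omega> B n \<ge> 0" for n using B by (simp add: \<omega>_def)
  from near_far_contradiction[OF \<rho>_nonneg \<rho>_le this summable_\<omega> g C' w_bounds \<rho>_step nf x l]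
  show False .
qed

end

section \<open>Nonvanishing tails\<close>

lemma bounded_linear_Re_dir: "bounded_linear (Re_dir \<zeta>)"
  unfolding Re_dir_def using bounded_linear_compose[OF bounded_linear_Re bounded_linear_mult_right] .

lemma Re_dir_of_rat: "Re_dir \<zeta> (of_rat r * z) = of_rat r * Re_dir \<zeta> z"
proof -
  have "of_rat r * z = of_rat r *\<^sub>R z"
    by (cases r) (simp add: of_rat_rat scaleR_conv_of_real)
  thus ?thesis using bounded_linear.linear[OF bounded_linear_Re_dir, of \<zeta>]
    by (simp add: linear_cmul)
qed

text \<open>From some index on all terms have a real part in direction \<open>\<zeta>\<close> of one
  and the same sign, so the tail has nonzero real part in that direction.\<close>

lemma tail_nonzero:
  fixes z :: "nat \<Rightarrow> nat \<Rightarrow> complex" and q :: "nat \<Rightarrow> rat"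
  assumes q: "\<exists>i\<in>{1..K}. q i \<noteq> 0"
    and pos: "\<And>i n. 1 \<le> i \<Longrightarrow> i \<le> K \<Longrightarrow> n \<ge> 1 \<Longrightarrow> Re_dir \<zeta> (z i n) > 0"
    and lim: "\<And>i j. 1 \<le> i \<Longrightarrow> i < j \<Longrightarrow> j \<le> K \<Longrightarrow>
      (\<lambda>n. Re_dir \<zeta> (z i n) / Re_dir \<zeta> (z j n)) \<longlonglongrightarrow> 0"
    and sum: "summable (\<lambda>n. \<Sum>i=1..K. of_rat (q i) * z i n)"
  shows "\<exists>N0. \<forall>N\<ge>N0. (\<Sum>n. \<Sum>i=1..K. of_rat (q i) * z i (n + N)) \<noteq> 0"
proof -
  interpret Re: bounded_linear "Re_dir \<zeta>" by (rule bounded_linear_Re_dir)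
  define t where "t n = (\<Sum>i=1..K. of_rat (q i) * z i n)" for n
  define x where "x i n = Re_dir \<zeta> (z i n)" for i n
  \<comment> \<open>The largest index with a nonzero coefficient dominates and so determines the sign.\<close>
  define j where "j = Max {i\<in>{1..K}. q i \<noteq> 0}"
  have "j \<in> {i\<in>{1..K}. q i \<noteq> 0}" unfolding j_def using q by (intro Max_in) auto
  hence j: "1 \<le> j" "j \<le> K" "q j \<noteq> 0" by auto
  have q0: "q i = 0" if "i \<in> {1..K}" "i > j" for i
    using that Max_ge[of "{i\<in>{1..K}. q i \<noteq> 0}" i] unfolding j_def by fastforce
  define r where "r i = (of_rat (q i) :: real)" for i
  define s where "s = sgn (r j)"
  \<comment> \<open>Divided by the positive \<open>x j n\<close>, the real part of a term tends to
    \<open>r j\<close>; the factor \<open>s\<close> makes the limit positive.\<close>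
  have "(\<lambda>n. s * (r j + (\<Sum>i\<in>{1..<j}. r i * (x i n / x j n)))) \<longlonglongrightarrow> s * (r j + (\<Sum>i\<in>{1..<j}. r i * 0))"
    unfolding x_def using j by (intro tendsto_intros lim) auto
  moreover have "s * (r j + (\<Sum>i\<in>{1..<j}. r i * 0)) > 0"
    using j by (simp add: s_def r_def sgn_mult_self_eq flip: abs_sgn abs_sgn_eq) (simp add: sgn_if)
  ultimately have "\<forall>\<^sub>F n in sequentially. s * (r j + (\<Sum>i\<in>{1..<j}. r i * (x i n / x j n))) > 0"
    by (rule order_tendstoD)
  then obtain N0 where N0: "\<And>n. n \<ge> N0 \<Longrightarrow> s * (r j + (\<Sum>i\<in>{1..<j}. r i * (x i n / x j n))) > 0"
    by (auto simp: eventually_sequentially)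
  have spos: "s * Re_dir \<zeta> (t n) > 0" if n: "n \<ge> max 1 N0" for n
  proof -
    have xj: "x j n > 0" unfolding x_def using pos j n by auto
    have "Re_dir \<zeta> (t n) = (\<Sum>i=1..K. r i * x i n)"
      by (simp add: t_def Re.sum Re_dir_of_rat r_def x_def)
    also have "\<dots> = (\<Sum>i=1..j. r i * x i n)"
      using j q0 by (intro sum.mono_neutral_right) (auto simp: r_def)
    also have "{1..j} = insert j {1..<j}" using j by auto
    also have "(\<Sum>i\<in>insert j {1..<j}. r i * x i n) = x j n * (r j + (\<Sum>i\<in>{1..<j}. r i * (x i n / x j n)))"
      using xj by (simp add: distrib_left sum_distrib_left mult.commute)
    finally have "s * Re_dir \<zeta> (t n) = x j n * (s * (r j + (\<Sum>i\<in>{1..<j}. r i * (x i n / x j n))))" by simp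
    also have "\<dots> > 0" using n by (intro mult_pos_pos[OF xj N0]) auto
    finally show ?thesis .
  qed
  have "(\<Sum>n. t (n + N)) \<noteq> 0" if N: "N \<ge> max 1 N0" for N
  proof
    assume 0: "(\<Sum>n. t (n + N)) = 0"
    have "summable (\<lambda>n. t (n + N))"
      using sum unfolding t_def[symmetric] by (rule summable_ignore_initial_segment)
    hence *: "summable (\<lambda>n. Re_dir \<zeta> (t (n + N)))" "(\<Sum>n. Re_dir \<zeta> (t (n + N))) = 0"
      using Re.summable Re.suminf[of "\<lambda>n. t (n + N)"] 0 by (auto simp: Re.zero)
    have "0 < (\<Sum>n. s * Re_dir \<zeta> (t (n + N)))"
      using spos N by (intro suminf_pos summable_mult *) auto
    also have "\<dots> = 0" using *(2) by (simp add: suminf_mult[OF *(1)])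
    finally show False by simp
  qed
  thus ?thesis unfolding t_def by blast
qed

section \<open>The degree of linear combinations of the series\<close>

theorem theorem1p4:
  fixes D K :: nat and A1 A2 a \<epsilon> :: real and \<zeta> :: complex
    and d :: "nat \<Rightarrow> nat" and b :: "nat \<Rightarrow> nat \<Rightarrow> nat" and \<alpha> :: "nat \<Rightarrow> nat \<Rightarrow> complex"
  defines "Dp \<equiv> (\<lambda>n. \<Prod>i=1..n. d i)"
  assumes D_pos: "D \<ge> 1" and K_pos: "K \<ge> 1"
    and pos: "A1 > 0" "A2 > 0" "a > 0" "\<epsilon> > 0"
    and aA: "a < 1" "1 \<le> A1" "A1 < A2"
    and zeta: "norm \<zeta> = 1"
    and d_nat: "\<And>n. n \<ge> 1 \<Longrightarrow> d n \<ge> 1"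
    and b_nat: "\<And>i n. 1 \<le> i \<Longrightarrow> i \<le> K \<Longrightarrow> n \<ge> 1 \<Longrightarrow> b i n \<ge> 1"
    and alg_int: "\<And>i n. 1 \<le> i \<Longrightarrow> i \<le> K \<Longrightarrow> n \<ge> 1 \<Longrightarrow> algebraic_int (\<alpha> i n)"
    and h1: "\<And>n. n \<ge> 1 \<Longrightarrow> norm (\<alpha> 1 n) < norm (\<alpha> 1 (n + 1))"
    and h2: "\<And>n. n \<ge> 1 \<Longrightarrow> norm (\<alpha> 1 n) \<ge> real n powr (1 + \<epsilon>)"
    and h3: "\<And>n. n \<ge> 1 \<Longrightarrow> field_degree_Q ((\<lambda>i. \<alpha> i n) ` {1..K}) \<le> d n"
    and h4: "liminf (\<lambda>n. ereal (norm (\<alpha> 1 n) powr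
                 (1 / (real D ^ n * (\<Prod>i=1..n-1. real (K * Dp i + d i)))))) = ereal A1"
    and h5: "limsup (\<lambda>n. ereal (norm (\<alpha> 1 n) powr
                 (1 / (real D ^ n * (\<Prod>i=1..n-1. real (K * Dp i + d i)))))) = ereal A2"
    and h6: "\<And>n i. n \<ge> 1 \<Longrightarrow> 1 < i \<Longrightarrow> i \<le> K \<Longrightarrow>
               2 powr (- ((log 2 (norm (\<alpha> 1 n))) powr a)) < norm (\<alpha> 1 n) / norm (\<alpha> i n) \<and>
               norm (\<alpha> 1 n) / norm (\<alpha> i n) < 2 powr ((log 2 (norm (\<alpha> 1 n))) powr a)"
    and h7: "\<And>n i. n \<ge> 1 \<Longrightarrow> 1 \<le> i \<Longrightarrow> i \<le> K \<Longrightarrow>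
               real (b i n) * house (\<alpha> i n) \<le> 2 powr ((log 2 (norm (\<alpha> 1 n))) powr a) * norm (\<alpha> i n)"
    and h8: "\<And>n i. n \<ge> 1 \<Longrightarrow> 1 \<le> i \<Longrightarrow> i \<le> K \<Longrightarrow> Re_dir \<zeta> (of_nat (b i n) / \<alpha> i n) > 0"
    and h9: "\<And>i j. 1 \<le> i \<Longrightarrow> i < j \<Longrightarrow> j \<le> K \<Longrightarrow>
               (\<lambda>n. Re_dir \<zeta> (of_nat (b i n) / \<alpha> i n) / Re_dir \<zeta> (of_nat (b j n) / \<alpha> j n))
                 \<longlonglongrightarrow> 0"
  shows "\<forall>q :: nat \<Rightarrow> rat. (\<exists>i\<in>{1..K}. q i \<noteq> 0) \<longrightarrow>
           alg_degree (\<Sum>i=1..K. of_rat (q i) * (\<Sum>n. of_nat (b i (Suc n)) / \<alpha> i (Suc n))) > enat D"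
proof (intro allI impI, rule ccontr)
  fix q :: "nat \<Rightarrow> rat"
  assume q: "\<exists>i\<in>{1..K}. q i \<noteq> 0"
  define \<gamma> where "\<gamma> = (\<Sum>i=1..K. of_rat (q i) * (\<Sum>n. of_nat (b i (Suc n)) / \<alpha> i (Suc n)))"
  assume "\<not> alg_degree (\<Sum>i=1..K. of_rat (q i) * (\<Sum>n. of_nat (b i (Suc n)) / \<alpha> i (Suc n))) > enat D"
  hence \<gamma>: "alg_degree \<gamma> \<le> enat D" by (simp add: \<gamma>_def not_less)
  define L where "L n = log 2 (norm (\<alpha> 1 n))" for n
  define e where "e n = real D ^ n * (\<Prod>i=1..n-1. real (K * Dp i + d i))" for n
  \<comment> \<open>Division by zero yields 0, which the positivity condition (8) rules out.\<close>
  have nz: "\<alpha> i n \<noteq> 0" if "1 \<le> i" "i \<le> K" "n \<ge> 1" for i n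
    using h8[OF that(3,1,2)] by (auto simp: Re_dir_def)
  have norm_eq: "norm (\<alpha> 1 n) = 2 powr L n" if "n \<ge> 1" for n
    using nz[of 1 n] that K_pos by (simp add: L_def)
  have e_pos: "e n > 0" for n
  proof -
    have "Dp i > 0" if "i \<ge> 1" for i using d_nat by (auto simp: Dp_def Suc_le_eq intro!: prod_pos)
    hence "0 < real (K * Dp i + d i)" if "i \<ge> 1" for i using K_pos that by (subst of_nat_0_less_iff) auto
    thus ?thesis unfolding e_def using D_pos
      by (intro mult_pos_pos prod_pos zero_less_power) auto
  qed
  have L_ge: "(1 + \<epsilon>) * log 2 (real n) \<le> L n" if n: "n \<ge> 1" for n
  proof -
    have "log 2 (real n powr (1 + \<epsilon>)) \<le> L n"
      unfolding L_def using h2[OF n] n by (intro log_mono) auto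
    thus ?thesis using n by (simp add: log_powr)
  qed
  have L_Suc: "L n \<le> L (Suc n)" if "n \<ge> 1" for n
    using h1[OF that] nz[of 1 n] that K_pos unfolding L_def by (intro log_mono) auto
  have L_mono: "L m \<le> L n" if "1 \<le> m" "m \<le> n" for m n
    using that(2)
  proof (induction n rule: dec_induct)
    case (step n)
    thus ?case using L_Suc[of n] that(1) by simp
  qed simp
  have log_ratio: "L n / e n = log 2 (norm (\<alpha> 1 n) powr (1 / e n))" if "n \<ge> 1" for n
    using nz[of 1 n] that K_pos by (simp add: L_def log_powr)
  have h4': "liminf (\<lambda>n. ereal (norm (\<alpha> 1 n) powr (1 / e n))) = ereal A1"
    and h5': "limsup (\<lambda>n. ereal (norm (\<alpha> 1 n) powr (1 / e n))) = ereal A2"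
    using h4 h5 by (simp_all add: e_def)
  have less: "L n / e n < log 2 x" if "n \<ge> 1" "norm (\<alpha> 1 n) powr (1 / e n) < x" for n x
    unfolding log_ratio[OF that(1)] using that nz[of 1 n] K_pos
    by (subst log_less_cancel_iff) (auto intro: order.strict_trans1[OF powr_ge_zero])
  have greater: "L n / e n > log 2 x" if "n \<ge> 1" "norm (\<alpha> 1 n) powr (1 / e n) > x" "x > 0" for n x
    unfolding log_ratio[OF that(1)] using that by (subst log_less_cancel_iff) auto
  have frequently_less: "\<exists>\<^sub>F n in sequentially. L n / e n < log 2 x" if "x > A1" for x
  proof -
    have "\<exists>\<^sub>F n in sequentially. norm (\<alpha> 1 n) powr (1 / e n) < x"
    proof (rule ccontr)
      assume "\<not> ?thesis"
      hence "\<forall>\<^sub>F n in sequentially. ereal x \<le> ereal (norm (\<alpha> 1 n) powr (1 / e n))"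
        by (simp add: not_frequently not_less)
      from Liminf_bounded[OF this] show False using that unfolding h4' by simp
    qed
    moreover have "\<forall>\<^sub>F n in sequentially. n \<ge> (1 :: nat)" by (rule eventually_ge_at_top)
    ultimately have "\<exists>\<^sub>F n in sequentially. norm (\<alpha> 1 n) powr (1 / e n) < x \<and> n \<ge> 1"
      by (rule frequently_eventually_frequently)
    thus ?thesis by (rule frequently_elim1) (auto intro: less)
  qed
  have frequently_greater: "\<exists>\<^sub>F n in sequentially. L n / e n > log 2 x" if "x < A2" "x > 0" for x
  proof -
    have "\<exists>\<^sub>F n in sequentially. norm (\<alpha> 1 n) powr (1 / e n) > x"
    proof (rule ccontr)
      assume "\<not> ?thesis"
      hence "\<forall>\<^sub>F n in sequentially. ereal (norm (\<alpha> 1 n) powr (1 / e n)) \<le> ereal x"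
        by (simp add: not_frequently not_less)
      from Limsup_bounded[OF this] show False using that unfolding h5' by simp
    qed
    moreover have "\<forall>\<^sub>F n in sequentially. n \<ge> (1 :: nat)" by (rule eventually_ge_at_top)
    ultimately have "\<exists>\<^sub>F n in sequentially. norm (\<alpha> 1 n) powr (1 / e n) > x \<and> n \<ge> 1"
      by (rule frequently_eventually_frequently)
    thus ?thesis by (rule frequently_elim1) (use that greater in auto)
  qed
  have "\<forall>\<^sub>F n in sequentially. ereal (norm (\<alpha> 1 n) powr (1 / e n)) < ereal (A2 + 1)"
    by (rule Limsup_lessD) (simp only: h5', simp)
  then obtain N1 where N1: "\<And>n. n \<ge> N1 \<Longrightarrow> norm (\<alpha> 1 n) powr (1 / e n) < A2 + 1"
    by (auto simp: eventually_sequentially)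
  \<comment> \<open>The logarithm bounds the quotients from \<open>N1\<close> on, the sum bounds the
    finitely many earlier ones, and the 1 ensures \<open>M \<ge> 1\<close>.\<close>
  define M where "M = 1 + \<bar>log 2 (A2 + 1)\<bar> + (\<Sum>n<N1. \<bar>L n / e n\<bar>)"
  have sum0: "(\<Sum>n<N1. \<bar>L n / e n\<bar>) \<ge> 0" by (intro sum_nonneg) auto
  have l_le: "L n / e n \<le> M" if n: "n \<ge> 1" for n
  proof (cases "n \<ge> N1")
    case True
    thus ?thesis using less[OF n N1[OF True]] sum0 by (simp add: M_def)
  next
    case False
    hence "\<bar>L n / e n\<bar> \<le> (\<Sum>n<N1. \<bar>L n / e n\<bar>)" by (intro member_le_sum) auto
    thus ?thesis unfolding M_def using abs_ge_self[of "L n / e n"] abs_ge_zero[of "log 2 (A2 + 1)"] by linarith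
  qed
  have L_le: "L n \<le> M * e n" if "n \<ge> 1" for n
    using l_le[OF that] e_pos[of n] by (simp add: pos_divide_le_eq)
  interpret hg: height_growth D K d L a \<epsilon> M
  proof
    show "M \<ge> 1" using sum0 by (simp add: M_def)
    show "L n \<le> M * (real D ^ n * (\<Prod>i=1..n-1. real (K * (\<Prod>j=1..i. d j) + d i)))" if "n \<ge> 1" for n
      using L_le[OF that] by (simp add: e_def Dp_def)
  qed (use D_pos K_pos d_nat pos aA L_mono L_ge in auto)
  have E_eq: "hg.E n = e n" for n by (simp add: hg.E_def e_def Dp_def hg.Dp_def)
  have \<alpha>_le: "norm (\<alpha> 1 n) \<le> 2 powr (L n powr a) * norm (\<alpha> i n)"
    "norm (\<alpha> i n) \<le> 2 powr (L n powr a) * norm (\<alpha> 1 n)" if "n \<ge> 1" "1 \<le> i" "i \<le> K" for n i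
  proof -
    have ge1: "(2 :: real) powr (L n powr a) \<ge> 1" by (intro ge_one_powr_ge_zero) auto
    have "norm (\<alpha> 1 n) \<le> 2 powr (L n powr a) * norm (\<alpha> i n) \<and>
      norm (\<alpha> i n) \<le> 2 powr (L n powr a) * norm (\<alpha> 1 n)"
    proof (cases "i = 1")
      case True
      thus ?thesis using mult_right_mono[OF ge1, of "norm (\<alpha> 1 n)"] by simp
    next
      case False
      hence i: "1 < i" using that by simp
      show ?thesis using h6[OF that(1) i that(3)] nz[OF that(2,3,1)] unfolding L_def[symmetric]
        by (simp add: field_simps powr_minus)
    qed
    thus "norm (\<alpha> 1 n) \<le> 2 powr (L n powr a) * norm (\<alpha> i n)"
      "norm (\<alpha> i n) \<le> 2 powr (L n powr a) * norm (\<alpha> 1 n)" by auto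
  qed
  define u where "u n = 2 powr (- (L n - 2 * L n powr a))" for n
  \<comment> \<open>The house is at least \<open>norm (\<alpha> i n)\<close>, so (7) bounds
    \<open>b i n\<close> by \<open>2 powr (L n powr a)\<close>. By (6) the denominator loses at most
    another such factor against \<open>2 powr L n\<close>.\<close>
  have term_le: "norm (of_nat (b i n) / \<alpha> i n) \<le> u n" if n: "n \<ge> 1" "1 \<le> i" "i \<le> K" for n i
  proof -
    have al: "norm (\<alpha> i n) > 0" using nz[OF n(2,3,1)] by simp
    have "norm (\<alpha> i n) \<le> house (\<alpha> i n)"
      using alg_int[OF n(2,3,1)] by (intro norm_le_house algebraic_int_imp_algebraic)
    hence "b i n * norm (\<alpha> i n) \<le> b i n * house (\<alpha> i n)" by (intro mult_left_mono) auto
    also have "\<dots> \<le> 2 powr (L n powr a) * norm (\<alpha> i n)" using h7[OF n] by (simp add: L_def)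
    finally have b: "b i n \<le> 2 powr (L n powr a)" using al by simp
    have "2 powr L n \<le> 2 powr (L n powr a) * norm (\<alpha> i n)" using \<alpha>_le(1)[OF n] norm_eq[OF n(1)] by simp
    hence "b i n * 2 powr L n \<le> 2 powr (L n powr a) * (2 powr (L n powr a) * norm (\<alpha> i n))"
      using b by (intro mult_mono) auto
    hence "b i n / norm (\<alpha> i n) \<le> 2 powr (L n powr a) * 2 powr (L n powr a) / 2 powr L n"
      using al by (simp add: field_simps)
    also have "\<dots> = u n" unfolding u_def by (simp flip: powr_add powr_diff)
    finally show ?thesis by (simp add: norm_divide)
  qed
  have u: "summable u" using hg.summable_powr_neg_L by (simp add: u_def[abs_def])
  define Q where "Q = (\<Sum>i=1..K. norm (of_rat (q i) :: complex))"
  define t where "t n = (\<Sum>i=1..K. of_rat (q i) * (of_nat (b i n) / \<alpha> i n))" for n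
  have t_le: "norm (t n) \<le> Q * u n" if n: "n \<ge> 1" for n
    unfolding t_def Q_def sum_distrib_right
  proof (intro sum_norm_le)
    fix i assume "i \<in> {1..K}"
    thus "norm (of_rat (q i) * (of_nat (b i n) / \<alpha> i n)) \<le> norm (of_rat (q i) :: complex) * u n"
      unfolding norm_mult using n by (intro mult_left_mono term_le) auto
  qed
  have summable_term: "summable (\<lambda>n. of_nat (b i n) / \<alpha> i n)" if "1 \<le> i" "i \<le> K" for i
    by (rule summable_comparison_test_ev[OF _ u])
      (use that term_le in \<open>auto simp: eventually_sequentially\<close>)
  have summable_t: "summable t"
    unfolding t_def by (intro summable_sum summable_mult summable_term) auto
  have t_Suc: "summable (\<lambda>n. t (Suc n))" using summable_t by (simp only: summable_Suc_iff)
  have \<gamma>_eq: "\<gamma> = (\<Sum>n. t (Suc n))"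
  proof -
    have s: "summable (\<lambda>n. of_nat (b i (Suc n)) / \<alpha> i (Suc n))" if "i \<in> {1..K}" for i
      using summable_term[of i] that by (subst summable_Suc_iff) auto
    have "(\<Sum>n. t (Suc n)) = (\<Sum>i=1..K. \<Sum>n. of_rat (q i) * (of_nat (b i (Suc n)) / \<alpha> i (Suc n)))"
      unfolding t_def by (intro suminf_sum summable_mult s)
    also have "\<dots> = \<gamma>" unfolding \<gamma>_def by (intro sum.cong refl suminf_mult s)
    finally show ?thesis by simp
  qed
  define y where "y N = \<gamma> - (\<Sum>n=1..N. t n)" for N
  \<comment> \<open>The series of the theorem start at index 1, so \<open>t 0\<close> is left out
    and the tail after \<open>N\<close> begins at \<open>Suc N\<close>.\<close>
  have y_eq: "y N = (\<Sum>n. t (n + Suc N))" for N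
  proof -
    have "(\<Sum>n=1..N. t n) = (\<Sum>n<N. t (Suc n))"
      by (rule sum.reindex_bij_witness[of _ Suc "\<lambda>n. n - 1"]) auto
    thus ?thesis unfolding y_def \<gamma>_eq suminf_split_initial_segment[OF t_Suc, of N] by simp
  qed
  obtain N2 where N2: "\<And>N. N \<ge> N2 \<Longrightarrow> (\<Sum>n. t (n + N)) \<noteq> 0"
    using tail_nonzero[of K q \<zeta> "\<lambda>i n. of_nat (b i n) / \<alpha> i n"] q h8 h9 summable_t
    unfolding t_def by blast
  obtain C where C: "C \<ge> 1" "\<And>N. y N \<noteq> 0 \<Longrightarrow>
      1 \<le> norm (y N) * (C * (real N + 1) * (\<Prod>n=1..N. \<Prod>i=1..K. b i n * house (\<alpha> i n))) ^ (D * (\<Prod>n=1..N. d n))"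
  proof -
    have "\<exists>C\<ge>1. \<forall>N. y N \<noteq> 0 \<longrightarrow>
      1 \<le> norm (y N) * (C * (real N + 1) * (\<Prod>n=1..N. \<Prod>i=1..K. b i n * house (\<alpha> i n))) ^ (D * (\<Prod>n=1..N. d n))"
      unfolding y_def t_def by (rule partial_sum_lower_bound[OF \<gamma>]) (use b_nat alg_int nz h3 in auto)
    thus ?thesis using that by blast
  qed
  define c where "c = log 2 C"
  have c: "c \<ge> 0" using C by (simp add: c_def)
  have Q: "Q \<ge> 0" unfolding Q_def by (intro sum_nonneg) auto
  have bound: "2 powr (- hg.V c N) \<le> (Q + 1) * (\<Sum>n. 2 powr (- (L (n + Suc N) - 2 * L (n + Suc N) powr a)))"
    if N: "N \<ge> N2" for N
  proof -
    have y0: "y N \<noteq> 0" unfolding y_eq using N2[of "Suc N"] N by simp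
    define P where "P = (\<Prod>n=1..N. \<Prod>i=1..K. b i n * house (\<alpha> i n))"
    have house1: "house (\<alpha> i n) \<ge> 1" if "1 \<le> i" "i \<le> K" "n \<ge> 1" for i n
      using that by (intro house_ge_1 alg_int nz)
    have P0: "P \<ge> 0" unfolding P_def using house1
      by (intro prod_nonneg ballI mult_nonneg_nonneg) (auto intro: order_trans[OF zero_le_one])
    \<comment> \<open>Conditions (7) and (6) contribute one factor
      \<open>2 powr (L n powr a)\<close> each; hence the term \<open>2 * L n powr a\<close> in
      \<open>V\<close>.\<close>
    have "P \<le> (\<Prod>n=1..N. \<Prod>i=1..K. 2 powr (L n + 2 * L n powr a))"
      unfolding P_def
    proof (intro prod_mono conjI prod_nonneg ballI)
      fix n i assume "n \<in> {1..N}" "i \<in> {1..K}"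
      hence n: "n \<ge> 1" "1 \<le> i" "i \<le> K" by auto
      show "0 \<le> b i n * house (\<alpha> i n)" using house1[OF n(2,3,1)] by simp
      have "b i n * house (\<alpha> i n) \<le> 2 powr (L n powr a) * norm (\<alpha> i n)" using h7[OF n] by (simp add: L_def)
      also have "\<dots> \<le> 2 powr (L n powr a) * (2 powr (L n powr a) * 2 powr L n)"
        using \<alpha>_le(2)[OF n] norm_eq[OF n(1)] by (intro mult_left_mono) auto
      also have "\<dots> = 2 powr (L n + 2 * L n powr a)" by (simp flip: powr_add add: add_ac)
      finally show "b i n * house (\<alpha> i n) \<le> 2 powr (L n + 2 * L n powr a)" .
    qed (use house1 in \<open>auto intro!: mult_nonneg_nonneg intro: order_trans[OF zero_le_one]\<close>)
    also have "\<dots> = 2 powr (K * (\<Sum>n=1..N. L n + 2 * L n powr a))"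
      by (simp add: powr_sum powr_realpow[symmetric] powr_powr prod_constant sum_distrib_left mult.commute)
    finally have P: "P \<le> 2 powr (K * (\<Sum>n=1..N. L n + 2 * L n powr a))" .
    have "C * (real N + 1) * P \<le> 2 powr c * 2 powr (log 2 (real N + 1)) * 2 powr (K * (\<Sum>n=1..N. L n + 2 * L n powr a))"
      using C(1) P P0 by (intro mult_mono) (auto simp: c_def)
    also have "\<dots> = 2 powr (c + log 2 (real N + 1) + K * (\<Sum>n=1..N. L n + 2 * L n powr a))"
      by (simp only: powr_add)
    finally have "(C * (real N + 1) * P) ^ (D * (\<Prod>n=1..N. d n)) \<le> \<dots> ^ (D * (\<Prod>n=1..N. d n))"
      using C(1) P0 by (intro power_mono) auto
    also have "\<dots> = 2 powr hg.V c N"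
      by (simp add: hg.V_def hg.Dp_def powr_realpow[symmetric] powr_powr mult.commute)
    finally have "norm (y N) * (C * (real N + 1) * P) ^ (D * (\<Prod>n=1..N. d n)) \<le> norm (y N) * 2 powr hg.V c N"
      by (intro mult_left_mono) auto
    hence "1 \<le> norm (y N) * 2 powr hg.V c N" using C(2)[OF y0] unfolding P_def by linarith
    hence "2 powr (- hg.V c N) \<le> norm (y N)" by (simp add: powr_minus field_simps)
    also have "\<dots> \<le> (\<Sum>n. Q * u (n + Suc N))" unfolding y_eq
      by (intro norm_suminf_le t_le summable_mult summable_ignore_initial_segment u) auto
    also have "\<dots> = Q * (\<Sum>n. u (n + Suc N))"
      by (intro suminf_mult summable_ignore_initial_segment u)
    \<comment> \<open>\<open>Q\<close> may be smaller than 1, whereas the growth argument asks for a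
      constant that is at least 1.\<close>
    also have "\<dots> \<le> (Q + 1) * (\<Sum>n. u (n + Suc N))"
      by (intro mult_right_mono suminf_nonneg summable_ignore_initial_segment u) (auto simp: u_def)
    finally show ?thesis by (simp add: u_def)
  qed
  \<comment> \<open>Two values strictly between \<open>A1\<close> and \<open>A2\<close> separate the
    liminf from the limsup; since \<open>A1 \<ge> 1\<close>, the logarithm of the larger one is
    positive.\<close>
  obtain x where x: "A1 < x" "x < A2" using dense[OF aA(3)] by blast
  obtain z where z: "x < z" "z < A2" using dense[OF x(2)] by blast
  show False
  proof (rule hg.growth_contradiction[OF c _ bound])
    show "Q + 1 \<ge> 1" using Q by simp
    show "log 2 x < log 2 z" "0 < log 2 z" using x z aA by auto
    show "\<exists>\<^sub>F n in sequentially. L n / hg.E n < log 2 x" unfolding E_eq using x by (intro frequently_less)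
    show "\<exists>\<^sub>F n in sequentially. L n / hg.E n > log 2 z" unfolding E_eq using x z aA by (intro frequently_greater) auto
  qed
qed

end
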